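(* Let $\mathcal{R}=(V,R)$ be the random graph and let $f\in\mathrm{Aut}(\mathcal{R})$ have property $( * )$. Then the conjugacy class of $f$ in $\mathrm{Aut}(\mathcal{R})$ is a compact biter. If moreover $f$ has no finite orbits, then the conjugacy class of $f$ is a compact catcher.
   Context: The random graph $\mathcal{R}=(V,R)$ is the unique countable graph such that for every pair of finite disjoint $A,B\subset V$ there is $v$ with $xRv$ for $x\in A$ and $\neg(yRv)$ for $y\in B$; $\mathrm{Aut}(\mathcal{R})$ is a Polish group with the topology of pointwise convergence. For $f\in\mathrm{Aut}(\mathcal{R})$ and $A\subset V$, $\mathcal{O}^f(A)=\{f^k(v):v\in A,k\in\mathbb{Z}\}$. A vertex $v$ realizes $\tau:M\to\{0,1\}$ if for every $w\in M$: $wRv\iff\tau(w)=1$. $f$ has property $( * )$ if $f$ has only finitely many finite orbits and infinitely many infinite orbits, and for every finite $M\subset V$ and $\tau:M\to\{0,1\}$ there exists $v$ that realizes $\tau$ with $v\notin\mathcal{O}^f(M)$. In a Polish group $G$, a set $A$ is a compact catcher if for every compact $K\subset G$ there are $g,h\in G$ with $gKh\subset A$; it is a compact biter if for every compact $K\subset G$ there are an open $U$ with $U\cap K\neq\emptyset$ and $g,h\in G$ with $g(U\cap K)h\subset A$. *)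

theory Defs
  imports "HOL-Analysis.Analysis" "HOL-Algebra.Coset"
begin

text \<open>The vertex set is the whole type, which is countable by its class. The extension property
  forces it to be infinite.\<close>

definition random_graph :: "('v::countable \<Rightarrow> 'v \<Rightarrow> bool) \<Rightarrow> bool" where
  "random_graph R \<longleftrightarrow> symp R \<and> irreflp R \<and>
     (\<forall>A B. finite A \<and> finite B \<and> A \<inter> B = {} \<longrightarrow>
        (\<exists>v. (\<forall>x\<in>A. R x v) \<and> (\<forall>y\<in>B. \<not> R y v)))"

definition graph_aut :: "('v \<Rightarrow> 'v \<Rightarrow> bool) \<Rightarrow> ('v \<Rightarrow> 'v) monoid" where
  "graph_aut R = \<lparr>carrier = {f. bij f \<and> (\<forall>x y. R (f x) (f y) \<longleftrightarrow> R x y)}, mult = (\<circ>), one = id\<rparr>"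

lemma group_graph_aut: "group (graph_aut R)"
proof (rule groupI)
  fix f assume f: "f \<in> carrier (graph_aut R)"
  then have "bij f" and R: "\<And>x y. R (f x) (f y) \<longleftrightarrow> R x y" by (auto simp: graph_aut_def)
  then have "R (inv_into UNIV f x) (inv_into UNIV f y) \<longleftrightarrow> R x y" for x y
    using R[of "inv_into UNIV f x" "inv_into UNIV f y"] by (simp add: bij_is_surj surj_f_inv_f)
  then show "\<exists>g\<in>carrier (graph_aut R). g \<otimes>\<^bsub>graph_aut R\<^esub> f = \<one>\<^bsub>graph_aut R\<^esub>"
    using \<open>bij f\<close>
    by (intro bexI[of _ "inv_into UNIV f"]) (auto simp: graph_aut_def bij_imp_bij_inv bij_is_inj)
qed (auto simp: graph_aut_def bij_comp)

text \<open>Pointwise convergence, with the vertex set discrete.\<close>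

definition aut_topology :: "('v \<Rightarrow> 'v \<Rightarrow> bool) \<Rightarrow> ('v \<Rightarrow> 'v) topology" where
  "aut_topology R =
     subtopology (product_topology (\<lambda>_. discrete_topology UNIV) UNIV) (carrier (graph_aut R))"

definition orbit_set :: "('v \<Rightarrow> 'v \<Rightarrow> bool) \<Rightarrow> ('v \<Rightarrow> 'v) \<Rightarrow> 'v set \<Rightarrow> 'v set" where
  "orbit_set R f A = {(f [^]\<^bsub>graph_aut R\<^esub> k) v | v k. v \<in> A \<and> k \<in> (UNIV :: int set)}"

definition orbits :: "('v \<Rightarrow> 'v \<Rightarrow> bool) \<Rightarrow> ('v \<Rightarrow> 'v) \<Rightarrow> 'v set set" where
  "orbits R f = {orbit_set R f {v} | v. True}"

text \<open>A map \<open>M \<rightarrow> {0,1}\<close> is given by a predicate on all vertices, of which only the values on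
  \<open>M\<close> matter.\<close>

definition realizes :: "('v \<Rightarrow> 'v \<Rightarrow> bool) \<Rightarrow> 'v set \<Rightarrow> ('v \<Rightarrow> bool) \<Rightarrow> 'v \<Rightarrow> bool" where
  "realizes R M \<tau> v \<longleftrightarrow> (\<forall>w\<in>M. R w v \<longleftrightarrow> \<tau> w)"

definition property_star :: "('v \<Rightarrow> 'v \<Rightarrow> bool) \<Rightarrow> ('v \<Rightarrow> 'v) \<Rightarrow> bool" where
  "property_star R f \<longleftrightarrow>
     finite {X \<in> orbits R f. finite X} \<and>
     infinite {X \<in> orbits R f. infinite X} \<and>
     (\<forall>M \<tau>. finite M \<longrightarrow> (\<exists>v. realizes R M \<tau> v \<and> v \<notin> orbit_set R f M))"

definition conjugacy_class :: "('a, 'b) monoid_scheme \<Rightarrow> 'a \<Rightarrow> 'a set" where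
  "conjugacy_class G f = {g \<otimes>\<^bsub>G\<^esub> f \<otimes>\<^bsub>G\<^esub> inv\<^bsub>G\<^esub> g | g. g \<in> carrier G}"

definition compact_catcher :: "('a, 'b) monoid_scheme \<Rightarrow> 'a topology \<Rightarrow> 'a set \<Rightarrow> bool" where
  "compact_catcher G T A \<longleftrightarrow>
     (\<forall>K. compactin T K \<longrightarrow>
        (\<exists>g\<in>carrier G. \<exists>h\<in>carrier G. g <#\<^bsub>G\<^esub> K #>\<^bsub>G\<^esub> h \<subseteq> A))"

text \<open>The compact set has to be nonempty here, since no open set meets the empty set.\<close>

definition compact_biter :: "('a, 'b) monoid_scheme \<Rightarrow> 'a topology \<Rightarrow> 'a set \<Rightarrow> bool" where
  "compact_biter G T A \<longleftrightarrow>
     (\<forall>K. compactin T K \<and> K \<noteq> {} \<longrightarrow>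
        (\<exists>U. openin T U \<and> U \<inter> K \<noteq> {} \<and>
           (\<exists>g\<in>carrier G. \<exists>h\<in>carrier G. g <#\<^bsub>G\<^esub> (U \<inter> K) #>\<^bsub>G\<^esub> h \<subseteq> A)))"

end

theory Submission
  imports Defs
begin

text \<open>Left translation by some \<open>k\<^sub>0 \<in> K\<close> and restriction to the open set of automorphisms
  agreeing with \<open>k\<^sub>0\<close> on the finite union \<open>F\<close> of the finite \<open>f\<close>-orbits reduce both claims to the
  following: if all \<open>k \<in> K\<close> fix \<open>F\<close> pointwise, then some automorphism \<open>h\<close> makes every \<open>k \<circ> h\<close>
  conjugate to \<open>f\<close>. By compactness only finitely many restrictions of \<open>k \<in> K\<close> to a finite set
  exist, so \<open>h\<close> can be built by back and forth together with all the conjugators \<open>\<phi>\<^sub>k\<close>. A finite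
  stage prescribes, through \<open>f (\<phi>\<^sub>k x)\<close>, the relations of \<open>h x\<close> with finitely many points; the
  prescriptions coming from different \<open>k\<close> are kept compatible by always choosing the value
  \<open>y = h x\<close> such that \<open>k y = k' y\<close> forces \<open>k\<close> and \<open>k'\<close> to agree on everything used so far.\<close>

section \<open>Orbits and partial conjugators\<close>

text \<open>If \<open>\<phi> \<circ> (k \<circ> h) = f \<circ> \<phi>\<close> for an automorphism
  \<open>\<phi>\<close>, then \<open>R (h x) w\<close> is equivalent to
  \<open>R (f (\<phi> x)) (\<phi> (k w))\<close>. The left side does not mention \<open>k\<close>,
  so all conjugators whose domains contain \<open>x\<close> and the respective \<open>k w\<close>
  must predict the same value; separate constructions for each \<open>k\<close> would violate this.
  On the finite orbits nothing can be chosen freely: the construction starts with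
  \<open>\<phi>\<close> the identity and \<open>h = f\<close> on \<open>F\<close>, which forces
  every \<open>k\<close> to fix \<open>F\<close> pointwise. Without finite orbits this condition is
  void, hence a catcher instead of a biter. A new domain point of \<open>\<phi>\<close> gets its
  image from \<open>property_star\<close>, which leaves enough freedom to respect all predictions.
  Surjectivity of \<open>h\<close> reduces to totality by inverting \<open>f\<close>,
  \<open>h\<close> and the elements of \<open>K\<close>. The range of \<open>\<phi>\<close> is the
  delicate side, because a prescribed image \<open>u\<close> brings along its own value of
  \<open>R (f u) u\<close>. It is enough to meet each \<open>f\<close>-orbit once, since in the
  limit the range is invariant under \<open>f\<close> and its inverse.\<close>

abbreviation inv_map :: "('a \<Rightarrow> 'b) \<Rightarrow> 'b \<Rightarrow> 'a" where
  "inv_map \<equiv> inv_into UNIV"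

lemma graph_aut_iff:
  "f \<in> carrier (graph_aut R) \<longleftrightarrow> bij f \<and> (\<forall>x y. R (f x) (f y) \<longleftrightarrow> R x y)"
  by (simp add: graph_aut_def)

lemma inv_map_graph_aut:
  assumes "f \<in> carrier (graph_aut R)"
  shows "inv_map f \<in> carrier (graph_aut R)"
proof -
  have b: "bij f" and R: "\<And>x y. R (f x) (f y) \<longleftrightarrow> R x y"
    using assms by (auto simp: graph_aut_iff)
  have "R (inv_map f x) (inv_map f y) \<longleftrightarrow> R x y" for x y
    using R[of "inv_map f x" "inv_map f y"] b by (simp add: bij_is_surj surj_f_inv_f)
  then show ?thesis
    using b by (simp add: graph_aut_iff bij_imp_bij_inv)
qed

text \<open>Natural powers in either direction stand for the integer powers behind
  \<open>orbit_set\<close>, so the combinatorial part can do without the group structure.\<close>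

definition same_orbit :: "('v \<Rightarrow> 'v) \<Rightarrow> 'v \<Rightarrow> 'v \<Rightarrow> bool" where
  "same_orbit f v w \<longleftrightarrow> (\<exists>n. (f ^^ n) v = w \<or> (f ^^ n) w = v)"

lemma funpow_inv_map:
  fixes f :: "'a \<Rightarrow> 'a"
  assumes "bij f"
  shows "(inv_map f ^^ n) v = w \<longleftrightarrow> (f ^^ n) w = v"
proof -
  have "bij (f ^^ n)" using assms by simp
  then show ?thesis
    using inv_fn[OF assms, of n] by (metis bij_inv_eq_iff)
qed

lemma same_orbit_sym: "same_orbit f v w \<longleftrightarrow> same_orbit f w v"
  by (auto simp: same_orbit_def)

lemma same_orbit_inv_map: "bij f \<Longrightarrow> same_orbit (inv_map f) v w \<longleftrightarrow> same_orbit f v w"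
  by (auto simp: same_orbit_def funpow_inv_map)

lemma same_orbit_funpow: "same_orbit f v ((f ^^ n) v)" "same_orbit f ((f ^^ n) v) v"
  by (auto simp: same_orbit_def)

lemma same_orbit_refl: "same_orbit f v v"
  using same_orbit_funpow(1)[where n = 0] by simp

lemma same_orbit_step: "same_orbit f v (f v)" "same_orbit f (f v) v"
  using same_orbit_funpow[where n = 1] by simp_all

lemma same_orbit_apply:
  assumes "inj f"
  shows "same_orbit f (f v) w \<longleftrightarrow> same_orbit f v w"
proof
  assume "same_orbit f (f v) w"
  then consider n where "(f ^^ n) (f v) = w" | n where "(f ^^ n) w = f v"
    by (auto simp: same_orbit_def)
  then show "same_orbit f v w"
  proof cases
    case 1
    then show ?thesis
      using same_orbit_funpow(1)[where f = f and n = "Suc n" and v = v] by (simp add: funpow_swap1)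
  next
    case (2 n)
    then show ?thesis
      by (cases n) (auto simp: same_orbit_step dest: injD[OF assms] intro: same_orbit_funpow)
  qed
next
  assume "same_orbit f v w"
  then consider n where "(f ^^ n) v = w" | n where "(f ^^ n) w = v"
    by (auto simp: same_orbit_def)
  then show "same_orbit f (f v) w"
  proof cases
    case (1 n)
    show ?thesis
    proof (cases n)
      case 0
      then show ?thesis using 1 by (simp add: same_orbit_step)
    next
      case (Suc m)
      then have "(f ^^ m) (f v) = w" using 1 by (simp add: funpow_swap1)
      then show ?thesis by (auto intro: same_orbit_funpow)
    qed
  next
    case (2 n)
    then show ?thesis
      using same_orbit_funpow(2)[where f = f and n = "Suc n" and v = w] by simp
  qed
qed

definition partial_iso :: "('v \<Rightarrow> 'v \<Rightarrow> bool) \<Rightarrow> ('v \<times> 'v) set \<Rightarrow> bool" where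
  "partial_iso R r \<longleftrightarrow>
     (\<forall>a b a' b'. (a, b) \<in> r \<longrightarrow> (a', b') \<in> r \<longrightarrow> (a = a' \<longleftrightarrow> b = b') \<and> (R a a' \<longleftrightarrow> R b b'))"

lemma partial_isoD:
  assumes "partial_iso R r" "(a, b) \<in> r" "(a', b') \<in> r"
  shows "a = a' \<longleftrightarrow> b = b'" "R a a' \<longleftrightarrow> R b b'"
  using assms unfolding partial_iso_def by blast+

lemma partial_iso_insert:
  assumes "symp R" "irreflp R" "partial_iso R r" "z \<notin> Domain r" "v \<notin> Range r"
    and "\<And>d e. (d, e) \<in> r \<Longrightarrow> R d z \<longleftrightarrow> R e v"
  shows "partial_iso R (insert (z, v) r)"
proof -
  have irr: "\<not> R a a" and sm: "R a b \<longleftrightarrow> R b a" for a b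
    using assms(1,2) by (auto simp: irreflp_def dest: sympD)
  show ?thesis
    unfolding partial_iso_def
  proof (intro allI impI)
    fix a b a' b'
    assume ab: "(a, b) \<in> insert (z, v) r" and ab': "(a', b') \<in> insert (z, v) r"
    show "(a = a' \<longleftrightarrow> b = b') \<and> (R a a' \<longleftrightarrow> R b b')"
    proof (cases "(a, b) \<in> r")
      case True
      show ?thesis
      proof (cases "(a', b') \<in> r")
        case True
        then show ?thesis using \<open>(a, b) \<in> r\<close> partial_isoD[OF assms(3)] by blast
      next
        case False
        then have "a' = z" "b' = v" using ab' by auto
        then show ?thesis using True assms(4,5,6) by blast
      qed
    next
      case False
      then have *: "a = z" "b = v" using ab by auto
      show ?thesis
      proof (cases "(a', b') \<in> r")
        case True
        then have "a' \<noteq> z" "b' \<noteq> v" using assms(4,5) by blast+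
        then show ?thesis using True assms(6) * sm by metis
      next
        case False
        then show ?thesis using ab' * irr by auto
      qed
    qed
  qed
qed

lemma finite_Range_partial_iso:
  assumes "partial_iso R r" "finite (Domain r)"
  shows "finite (Range r)"
proof -
  have "Range r \<subseteq> (\<lambda>x. THE v. (x, v) \<in> r) ` Domain r"
  proof
    fix v assume "v \<in> Range r"
    then obtain x where x: "(x, v) \<in> r" by blast
    then have "(THE v. (x, v) \<in> r) = v"
      using partial_isoD(1)[OF assms(1)] by blast
    then show "v \<in> (\<lambda>x. THE v. (x, v) \<in> r) ` Domain r"
      using x by force
  qed
  then show ?thesis using assms(2) finite_surj by blast
qed

text \<open>A finite part \<open>r\<close> of a map \<open>\<phi>\<close> with \<open>\<phi> \<circ> (k \<circ> h) = f \<circ> \<phi>\<close>. The converse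
  and convexity clauses say that each \<open>f\<close>-orbit meets the range in consecutive points, which
  come from one string of \<open>k \<circ> h\<close>.\<close>

definition partial_conjugator ::
  "('v \<Rightarrow> 'v \<Rightarrow> bool) \<Rightarrow> ('v \<Rightarrow> 'v) \<Rightarrow> 'v set \<Rightarrow> ('v \<times> 'v) set \<Rightarrow> ('v \<Rightarrow> 'v) \<Rightarrow> ('v \<times> 'v) set \<Rightarrow> bool"
  where
  "partial_conjugator R f F h k r \<longleftrightarrow>
     partial_iso R r \<and>
     (\<forall>a b. (a, b) \<in> h \<longrightarrow> (\<exists>v. (a, v) \<in> r \<and> (k b, f v) \<in> r)) \<and>
     (\<forall>x v w. (x, v) \<in> r \<longrightarrow> (k w, f v) \<in> r \<longrightarrow> (x, w) \<in> h) \<and>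
     (\<forall>v m n. v \<in> Range r \<longrightarrow> (f ^^ n) v \<in> Range r \<longrightarrow> m \<le> n \<longrightarrow> (f ^^ m) v \<in> Range r) \<and>
     (\<forall>e\<in>F. (e, e) \<in> r)"

lemma partial_conjugatorD:
  assumes "partial_conjugator R f F h k r"
  shows "partial_iso R r"
    and "(a, b) \<in> h \<Longrightarrow> \<exists>v. (a, v) \<in> r \<and> (k b, f v) \<in> r"
    and "(x, v) \<in> r \<Longrightarrow> (k w, f v) \<in> r \<Longrightarrow> (x, w) \<in> h"
    and "v \<in> Range r \<Longrightarrow> (f ^^ n) v \<in> Range r \<Longrightarrow> m \<le> n \<Longrightarrow> (f ^^ m) v \<in> Range r"
    and "e \<in> F \<Longrightarrow> (e, e) \<in> r"
  using assms unfolding partial_conjugator_def by blast+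

text \<open>Of the compact set \<open>K\<close> only the finiteness of its evaluations matters. The truth value of
  \<open>R (f v) v\<close> cannot be prescribed; \<open>\<epsilon>\<close> is a value that is compatible with every finite
  type extending a given type over the union \<open>F\<close> of the finite orbits.\<close>

locale twisting =
  fixes R :: "'v \<Rightarrow> 'v \<Rightarrow> bool" and f :: "'v \<Rightarrow> 'v" and F :: "'v set"
    and \<epsilon> :: "'v set \<Rightarrow> bool" and K :: "('v \<Rightarrow> 'v) set"
  assumes sym: "symp R" and irrefl: "irreflp R"
    and f_aut: "f \<in> carrier (graph_aut R)"
    and finite_F: "finite F"
    and F_iff: "x \<in> F \<longleftrightarrow> (\<exists>n>0. (f ^^ n) x = x)"
    and extension: "\<And>M \<tau>. finite M \<Longrightarrow> F \<subseteq> M \<Longrightarrow>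
      \<exists>v. (\<forall>w\<in>M. (R w v \<longleftrightarrow> \<tau> w) \<and> \<not> same_orbit f w v) \<and> (R (f v) v \<longleftrightarrow> \<epsilon> {e \<in> F. \<tau> e})"
    and K_nonempty: "K \<noteq> {}"
    and K_aut: "K \<subseteq> carrier (graph_aut R)"
    and K_fix: "\<And>k e. k \<in> K \<Longrightarrow> e \<in> F \<Longrightarrow> k e = e"
    and finite_image: "\<And>x. finite {k x | k. k \<in> K}"
    and finite_preimage: "\<And>x. finite {w. \<exists>k\<in>K. k w = x}"
begin

lemma f_bij: "bij f" and f_inj: "f x = f y \<longleftrightarrow> x = y" and f_R: "R (f x) (f y) \<longleftrightarrow> R x y"
  using f_aut by (auto simp: graph_aut_iff bij_is_inj inj_eq)

lemma K_bij: "k \<in> K \<Longrightarrow> bij k"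
  and K_inj: "k \<in> K \<Longrightarrow> k x = k y \<longleftrightarrow> x = y"
  and K_R: "k \<in> K \<Longrightarrow> R (k x) (k y) \<longleftrightarrow> R x y"
  using K_aut by (auto simp: graph_aut_iff bij_is_inj inj_eq)

lemma K_surj: "k \<in> K \<Longrightarrow> \<exists>w. k w = x"
  using K_bij bij_is_surj by (metis surjD)

lemma R_sym: "R x y \<longleftrightarrow> R y x"
  using sym by (auto dest: sympD)

section \<open>Points that separate automorphisms\<close>

text \<open>Used mainly in the combination \<open>pull (push A)\<close>, the set of all
  \<open>k'\<^sup>-\<^sup>1 (k a)\<close>. That both operations preserve finiteness is the form in
  which compactness enters.\<close>

definition push :: "'v set \<Rightarrow> 'v set" where
  "push A = (\<Union>k\<in>K. k ` A)"

definition pull :: "'v set \<Rightarrow> 'v set" where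
  "pull A = {w. \<exists>k\<in>K. k w \<in> A}"

lemma push_iff: "y \<in> push A \<longleftrightarrow> (\<exists>k\<in>K. \<exists>x\<in>A. k x = y)"
  by (auto simp: push_def)

lemma pull_iff: "w \<in> pull A \<longleftrightarrow> (\<exists>k\<in>K. k w \<in> A)"
  by (simp add: pull_def)

lemma finite_push: "finite A \<Longrightarrow> finite (push A)"
proof -
  assume "finite A"
  have "push A = (\<Union>x\<in>A. {k x | k. k \<in> K})" by (auto simp: push_def)
  then show ?thesis using \<open>finite A\<close> finite_image by simp
qed

lemma finite_pull: "finite A \<Longrightarrow> finite (pull A)"
proof -
  assume "finite A"
  have "pull A = (\<Union>x\<in>A. {w. \<exists>k\<in>K. k w = x})" by (auto simp: pull_def)
  then show ?thesis using \<open>finite A\<close> finite_preimage by simp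
qed

lemma extension_avoiding:
  assumes "finite W" "finite Z"
  obtains y where "y \<notin> Z" "\<And>w. w \<in> W \<Longrightarrow> R w y \<longleftrightarrow> \<tau> w"
proof -
  have "finite (W \<union> Z \<union> F)" using assms finite_F by simp
  then obtain y where y: "\<forall>w \<in> W \<union> Z \<union> F. (R w y \<longleftrightarrow> \<tau> w) \<and> \<not> same_orbit f w y"
    using extension[of "W \<union> Z \<union> F" \<tau>] by blast
  then have "y \<notin> Z" using same_orbit_refl[of f y] by auto
  then show thesis using y by (intro that) auto
qed

text \<open>If \<open>k y = k' y\<close>, then \<open>k'\<^sup>-\<^sup>1 \<circ> k\<close> permutes the neighbours of \<open>y\<close>.\<close>

lemma agree_transfer:
  assumes "\<And>t. t \<in> pull (push {s}) \<Longrightarrow> R t y \<longleftrightarrow> t = s"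
    and "k \<in> K" "k' \<in> K" "k y = k' y"
  shows "k s = k' s"
proof -
  \<comment> \<open>This \<open>t\<close> is \<open>k'\<^sup>-\<^sup>1 (k s)\<close>; it is a
    neighbour of \<open>y\<close> in \<open>pull (push {s})\<close>, where \<open>s\<close> is the
    only one.\<close>
  obtain t where t: "k' t = k s" using K_surj[OF assms(3)] by blast
  then have "t \<in> pull (push {s})"
    using assms(2,3) unfolding pull_iff push_iff by (metis singletonI)
  moreover have "s \<in> pull (push {s})"
    using assms(2) by (auto simp: pull_iff push_iff)
  then have "R (k s) (k y)" using assms(1,2) K_R by blast
  then have "R t y" using t assms(3,4) K_R by metis
  ultimately show ?thesis using assms(1) t by metis
qed

text \<open>The relation \<open>k t = k' s\<close> for some \<open>k\<close>, \<open>k'\<close> in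
  \<open>K\<close> is symmetric in \<open>s\<close> and \<open>t\<close>.\<close>

lemma push_pull_disjoint:
  assumes "s \<notin> pull (push A)"
  shows "pull (push {s}) \<inter> A = {}"
proof -
  have False if t: "t \<in> pull (push {s})" "t \<in> A" for t
  proof -
    obtain k k' where "k \<in> K" "k' \<in> K" "k t = k' s"
      using t(1) by (auto simp: pull_iff push_iff)
    then have "s \<in> pull (push A)"
      using t(2) unfolding pull_iff push_iff by metis
    then show False using assms by simp
  qed
  then show ?thesis by blast
qed

text \<open>Induction on \<open>W\<close>: the inductive \<open>s\<close> codes \<open>W\<close>,
  and the new point \<open>y\<close> has to code \<open>s\<close> and \<open>w\<close> together. By
  \<open>agree_transfer\<close> it suffices that \<open>s\<close> is the only neighbour of
  \<open>y\<close> in \<open>X\<close> and \<open>w\<close> the only one in \<open>Y\<close>. These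
  demands do not clash because \<open>X\<close> and \<open>Y\<close> are disjoint, which is why the
  induction hypothesis is used with \<open>pull (push Y)\<close> as the set to avoid.\<close>

lemma splitting_point:
  assumes "finite W" "finite Z"
  shows "\<exists>s. s \<notin> Z \<and> (\<forall>k\<in>K. \<forall>k'\<in>K. k s = k' s \<longrightarrow> (\<forall>w\<in>W. k w = k' w))"
  using assms
proof (induction W arbitrary: Z rule: finite_induct)
  case empty
  then obtain s where "s \<notin> Z" using extension_avoiding[of "{}" Z] by auto
  then show ?case by auto
next
  case (insert w W)
  define Y where "Y = pull (push {w})"
  have "finite Y" unfolding Y_def by (simp add: finite_pull finite_push)
  then have fin: "finite (pull (push Y))" by (simp add: finite_pull finite_push)
  obtain s where s: "s \<notin> pull (push Y)"
    "\<And>k k'. k \<in> K \<Longrightarrow> k' \<in> K \<Longrightarrow> k s = k' s \<Longrightarrow> \<forall>w\<in>W. k w = k' w"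
    using insert.IH[OF fin] by metis
  define X where "X = pull (push {s})"
  have "finite X" unfolding X_def by (simp add: finite_pull finite_push)
  have disj: "X \<inter> Y = {}" unfolding X_def using s(1) by (rule push_pull_disjoint)
  obtain y where y: "y \<notin> Z" "\<And>t. t \<in> X \<union> Y \<Longrightarrow> R t y \<longleftrightarrow> t = s \<or> t = w"
    using extension_avoiding[of "X \<union> Y" Z "\<lambda>t. t = s \<or> t = w"] \<open>finite X\<close> \<open>finite Y\<close> insert.prems by blast
  have "\<forall>u\<in>insert w W. k u = k' u" if k: "k \<in> K" "k' \<in> K" "k y = k' y" for k k'
  proof -
    have "s \<in> X" "w \<in> Y" using k by (auto simp: X_def Y_def pull_iff push_iff)
    then have "k s = k' s" "k w = k' w"
      using y(2) disj agree_transfer[OF _ k, of s] agree_transfer[OF _ k, of w]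
      unfolding X_def Y_def by blast+
    then show ?thesis using s(2) k by blast
  qed
  then show ?case using y(1) by blast
qed

text \<open>The relations of \<open>y\<close> to \<open>W\<close> are taken by \<open>\<tau>\<close>
  and cannot serve to compare \<open>k\<close> with \<open>k'\<close>. So an auxiliary
  \<open>s\<close> outside \<open>pull (push W)\<close> codes \<open>W\<close>, and \<open>y\<close>
  only has to be adjacent to \<open>s\<close> and to no other point of \<open>X\<close>.\<close>

lemma splitting_extension:
  assumes "finite W" "finite Z"
  obtains y where "y \<notin> Z" "\<And>w. w \<in> W \<Longrightarrow> R w y \<longleftrightarrow> \<tau> w"
    "\<And>k k' w. k \<in> K \<Longrightarrow> k' \<in> K \<Longrightarrow> k y = k' y \<Longrightarrow> w \<in> W \<Longrightarrow> k w = k' w"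
proof -
  have fin: "finite (pull (push W))" using assms by (simp add: finite_pull finite_push)
  obtain s where s: "s \<notin> pull (push W)"
    "\<And>k k'. k \<in> K \<Longrightarrow> k' \<in> K \<Longrightarrow> k s = k' s \<Longrightarrow> \<forall>w\<in>W. k w = k' w"
    using splitting_point[OF assms(1) fin] by metis
  define X where "X = pull (push {s})"
  have "finite X" unfolding X_def by (simp add: finite_pull finite_push)
  have disj: "X \<inter> W = {}" unfolding X_def using s(1) by (rule push_pull_disjoint)
  obtain y where y: "y \<notin> Z" "\<And>t. t \<in> X \<union> W \<Longrightarrow> R t y \<longleftrightarrow> (if t \<in> W then \<tau> t else t = s)"
    using extension_avoiding[of "X \<union> W" Z "\<lambda>t. if t \<in> W then \<tau> t else t = s"] \<open>finite X\<close> assms by blast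
  show thesis
  proof
    show "y \<notin> Z" by (rule y(1))
    show "R w y \<longleftrightarrow> \<tau> w" if "w \<in> W" for w using y(2) that by simp
    show "k w = k' w" if k: "k \<in> K" "k' \<in> K" "k y = k' y" and "w \<in> W" for k k' w
    proof -
      have "k s = k' s"
        using y(2) disj by (intro agree_transfer[OF _ k]) (auto simp: X_def)
      then show ?thesis using s(2) that by blast
    qed
  qed
qed

text \<open>As the orbit of \<open>v\<close> misses the range, neither \<open>f v\<close> nor the
  preimage of \<open>v\<close> is in it, so the clauses linking \<open>r\<close> to \<open>h\<close>
  gain no instance and convexity only the trivial one. The point \<open>v\<close> is not periodic
  because \<open>F\<close> lies in the range and \<open>v\<close> does not.\<close>

lemma partial_conjugator_insert_new:
  assumes L: "partial_conjugator R f F h k r"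
    and z: "z \<notin> Domain r"
    and adj: "\<And>d e. (d, e) \<in> r \<Longrightarrow> R d z \<longleftrightarrow> R e v"
    and new: "\<And>e. e \<in> Range r \<Longrightarrow> \<not> same_orbit f e v"
  shows "partial_conjugator R f F h k (insert (z, v) r)"
proof -
  note D = partial_conjugatorD[OF L]
  have v: "v \<notin> Range r" using new[of v] same_orbit_refl[of f v] by blast
  have "v \<notin> F" using D(5)[of v] v by auto
  then have vper: "(f ^^ n) v = v \<Longrightarrow> n = 0" for n using F_iff[of v] by auto
  have fv: "f v \<notin> Range r" "\<And>e. e \<in> Range r \<Longrightarrow> f e \<noteq> v"
    using new same_orbit_step by metis+
  have fn: "(f ^^ n) v \<notin> Range r" "\<And>e. e \<in> Range r \<Longrightarrow> (f ^^ n) e \<noteq> v" for n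
    using new same_orbit_funpow by metis+
  show ?thesis
    unfolding partial_conjugator_def
  proof (intro conjI allI impI ballI)
    show "partial_iso R (insert (z, v) r)"
      using D(1) z v adj by (intro partial_iso_insert sym irrefl) auto
    show "\<exists>u. (a, u) \<in> insert (z, v) r \<and> (k b, f u) \<in> insert (z, v) r" if "(a, b) \<in> h" for a b
      using D(2)[OF that] by blast
    show "(x, w) \<in> h" if "(x, u) \<in> insert (z, v) r" "(k w, f u) \<in> insert (z, v) r" for x u w
    proof -
      have "u \<noteq> v"
      proof
        assume "u = v"
        then have "f v = v \<or> f v \<in> Range r" using that(2) by auto
        then show False using vper[of 1] fv by auto
      qed
      then have "(x, u) \<in> r" using that by auto
      moreover from this have "(k w, f u) \<in> r" using that fv by auto
      ultimately show ?thesis using D(3) by blast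
    qed
    show "(f ^^ m) u \<in> Range (insert (z, v) r)"
      if "u \<in> Range (insert (z, v) r)" "(f ^^ n) u \<in> Range (insert (z, v) r)" "m \<le> n" for u m n
    proof (cases "u = v")
      case True
      then have "(f ^^ n) v = v" using that fn by auto
      then have "m = 0" using vper that(3) by auto
      then show ?thesis using that by simp
    next
      case False
      then have "u \<in> Range r" using that by auto
      moreover from this have "(f ^^ n) u \<in> Range r" using that fn by auto
      ultimately show ?thesis using D(4) that(3) by blast
    qed
    show "(e, e) \<in> insert (z, v) r" if "e \<in> F" for e using D(5) that by blast
  qed
qed

end

section \<open>Stages of the back-and-forth construction\<close>

text \<open>Coherence: a pair \<open>x\<close>, \<open>w\<close> may acquire its prescribed relation \<open>R (h x) w\<close> through
  several \<open>k\<close>, and these prescriptions must not conflict. The clause on \<open>\<epsilon>\<close> anticipates the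
  conflict at the moment when \<open>k' w\<close> starts a new orbit for \<open>k'\<close>.\<close>

locale conjugation_state = twisting R f F \<epsilon> K
  for R :: "'v \<Rightarrow> 'v \<Rightarrow> bool" and f F \<epsilon> K +
  fixes h :: "('v \<times> 'v) set" and P :: "('v \<Rightarrow> 'v) \<Rightarrow> ('v \<times> 'v) set"
  assumes h_iso: "partial_iso R h"
    and h_F: "\<And>e. e \<in> F \<Longrightarrow> (e, f e) \<in> h"
    and lifts: "\<And>k. k \<in> K \<Longrightarrow> partial_conjugator R f F h k (P k)"
    and coherent: "\<And>k k' x w v u v' u'. \<lbrakk>k \<in> K; k' \<in> K; (x, v) \<in> P k; (k w, u) \<in> P k;
      (x, v') \<in> P k'; (k' w, u') \<in> P k'\<rbrakk> \<Longrightarrow> R (f v) u \<longleftrightarrow> R (f v') u'"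
    and new_type: "\<And>k k' w v u. \<lbrakk>k \<in> K; k' \<in> K; (k' w, v) \<in> P k; (k w, u) \<in> P k;
      k' w \<notin> Domain (P k')\<rbrakk> \<Longrightarrow> R (f v) u \<longleftrightarrow> \<epsilon> {e \<in> F. R e w}"
    and finite_dom: "finite (\<Union>k\<in>K. Domain (P k))"
    and local_dep: "\<exists>E. finite E \<and> (\<forall>k\<in>K. \<forall>k'\<in>K. (\<forall>e\<in>E. k e = k' e) \<longrightarrow> P k = P k')"
begin

definition points :: "'v set" where
  "points = (\<Union>k\<in>K. Domain (P k))"

lemma finite_points: "finite points"
  using finite_dom by (simp add: points_def)

lemma pointsI: "k \<in> K \<Longrightarrow> (x, v) \<in> P k \<Longrightarrow> x \<in> points"
  by (auto simp: points_def)

lemma pull_pointsI: "k \<in> K \<Longrightarrow> (k w, v) \<in> P k \<Longrightarrow> w \<in> pull points"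
  by (auto simp: points_def pull_iff)

lemma P_iso: "k \<in> K \<Longrightarrow> partial_iso R (P k)"
  and P_F: "k \<in> K \<Longrightarrow> e \<in> F \<Longrightarrow> (e, e) \<in> P k"
  and P_convex: "k \<in> K \<Longrightarrow> v \<in> Range (P k) \<Longrightarrow> (f ^^ n) v \<in> Range (P k) \<Longrightarrow> m \<le> n
    \<Longrightarrow> (f ^^ m) v \<in> Range (P k)"
  and P_back: "k \<in> K \<Longrightarrow> (x, v) \<in> P k \<Longrightarrow> (k w, f v) \<in> P k \<Longrightarrow> (x, w) \<in> h"
  using partial_conjugatorD[OF lifts] by blast+

lemma P_inj: "k \<in> K \<Longrightarrow> (x, v) \<in> P k \<Longrightarrow> (x', v') \<in> P k \<Longrightarrow> x = x' \<longleftrightarrow> v = v'"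
  and P_R: "k \<in> K \<Longrightarrow> (x, v) \<in> P k \<Longrightarrow> (x', v') \<in> P k \<Longrightarrow> R x x' \<longleftrightarrow> R v v'"
  using partial_isoD[OF P_iso] by blast+

lemma P_h:
  assumes "k \<in> K" "(a, b) \<in> h"
  obtains v where "(a, v) \<in> P k" "(k b, f v) \<in> P k"
  using partial_conjugatorD(2)[OF lifts[OF assms(1)] assms(2)] by blast

lemma finite_Range_P: "k \<in> K \<Longrightarrow> finite (Range (P k))"
proof -
  assume k: "k \<in> K"
  then have "finite (Domain (P k))"
    using finite_dom by (rule_tac finite_subset[of _ "\<Union>k\<in>K. Domain (P k)"]) auto
  then show ?thesis using finite_Range_partial_iso[OF P_iso[OF k]] by blast
qed

text \<open>\<open>T x w\<close> is the value that \<open>R (h x) w\<close> has to take in the end.\<close>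

lemma promise:
  obtains T where
    "\<And>k x v w u. \<lbrakk>k \<in> K; (x, v) \<in> P k; (k w, u) \<in> P k\<rbrakk> \<Longrightarrow> T x w \<longleftrightarrow> R (f v) u"
    "\<And>k w. \<lbrakk>k \<in> K; k w \<notin> Domain (P k)\<rbrakk> \<Longrightarrow> T (k w) w \<longleftrightarrow> \<epsilon> {e \<in> F. R e w}"
    "\<And>x b w. (x, b) \<in> h \<Longrightarrow> T x w \<longleftrightarrow> R b w"
    "\<And>a w x. (a, w) \<in> h \<Longrightarrow> T x w \<longleftrightarrow> R x a"
proof -
  \<comment> \<open>Each disjunct is one reason for a value to be fixed already; where none applies
    the value is \<open>False\<close> by default. The second excludes the last two, since the
    entries of \<open>h\<close> lie in the domains concerned; the other overlaps agree by
    \<open>coherent\<close>, \<open>new_type\<close>, \<open>h1\<close>, \<open>h2\<close> and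
    \<open>h_iso\<close>.\<close>
  define T where "T x w \<longleftrightarrow>
    (\<exists>k v u. k \<in> K \<and> (x, v) \<in> P k \<and> (k w, u) \<in> P k \<and> R (f v) u) \<or>
    (\<exists>k. k \<in> K \<and> x = k w \<and> x \<notin> Domain (P k) \<and> \<epsilon> {e \<in> F. R e w}) \<or>
    (\<exists>b. (x, b) \<in> h \<and> R b w) \<or> (\<exists>a. (a, w) \<in> h \<and> R x a)" for x w
  have hdom: "x \<in> Domain (P k)" if "(x, b) \<in> h" "k \<in> K" for x b k
    using P_h[OF that(2,1)] by blast
  have hran: "k w \<in> Domain (P k)" if "(a, w) \<in> h" "k \<in> K" for a w k
    using P_h[OF that(2,1)] by blast
  have h1: "R (f v) u \<longleftrightarrow> R b w" if k: "k \<in> K" "(x, v) \<in> P k" "(k w, u) \<in> P k" "(x, b) \<in> h" for k x v w u b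
  proof -
    obtain v' where v': "(x, v') \<in> P k" "(k b, f v') \<in> P k" using P_h k(1,4) by blast
    then have "v' = v" using P_inj[OF k(1,2)] by blast
    then have "R (k b) (k w) \<longleftrightarrow> R (f v) u" using P_R[OF k(1) v'(2) k(3)] by simp
    then show ?thesis using K_R[OF k(1)] by simp
  qed
  have h2: "R (f v) u \<longleftrightarrow> R x a" if k: "k \<in> K" "(x, v) \<in> P k" "(k w, u) \<in> P k" "(a, w) \<in> h" for k x v w u a
  proof -
    obtain v' where v': "(a, v') \<in> P k" "(k w, f v') \<in> P k" using P_h k(1,4) by blast
    then have "f v' = u" using P_inj[OF k(1,3)] by blast
    then show ?thesis using P_R[OF k(1,2) v'(1)] f_R[of v v'] by simp
  qed
  show thesis
  proof (rule that[of T])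
    show "T x w \<longleftrightarrow> R (f v) u" if k: "k \<in> K" "(x, v) \<in> P k" "(k w, u) \<in> P k" for k x v w u
    proof
      assume "T x w"
      then consider (a) k' v' u' where "k' \<in> K" "(x, v') \<in> P k'" "(k' w, u') \<in> P k'" "R (f v') u'"
        | (b) k' where "k' \<in> K" "x = k' w" "x \<notin> Domain (P k')" "\<epsilon> {e \<in> F. R e w}"
        | (c) b where "(x, b) \<in> h" "R b w" | (d) a where "(a, w) \<in> h" "R x a"
        unfolding T_def by blast
      then show "R (f v) u"
      proof cases
        case a
        then show ?thesis using coherent[OF k(1) a(1) k(2,3) a(2,3)] by blast
      next
        case b
        then show ?thesis using new_type[OF k(1) b(1) _ k(3)] k(2) by blast
      next
        case c
        then show ?thesis using h1[OF k] by blast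
      next
        case d
        then show ?thesis using h2[OF k] by blast
      qed
    qed (use k in \<open>auto simp: T_def\<close>)
    show "T (k w) w \<longleftrightarrow> \<epsilon> {e \<in> F. R e w}" if k: "k \<in> K" "k w \<notin> Domain (P k)" for k w
    proof
      assume "T (k w) w"
      then consider (a) k' v' u' where "k' \<in> K" "(k w, v') \<in> P k'" "(k' w, u') \<in> P k'" "R (f v') u'"
        | (b) "\<epsilon> {e \<in> F. R e w}"
        | (c) b where "(k w, b) \<in> h" | (d) a where "(a, w) \<in> h"
        unfolding T_def by blast
      then show "\<epsilon> {e \<in> F. R e w}"
      proof cases
        case a
        then show ?thesis using new_type[OF a(1) k(1) a(2,3) k(2)] by blast
      next
        case c
        then show ?thesis using hdom k by blast
      next
        case d
        then show ?thesis using hran k by blast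
      qed
    qed (use k in \<open>auto simp: T_def\<close>)
    show "T x w \<longleftrightarrow> R b w" if xb: "(x, b) \<in> h" for x b w
    proof
      assume "T x w"
      then consider (a) k' v' u' where "k' \<in> K" "(x, v') \<in> P k'" "(k' w, u') \<in> P k'" "R (f v') u'"
        | (b) k' where "k' \<in> K" "x \<notin> Domain (P k')"
        | (c) b' where "(x, b') \<in> h" "R b' w" | (d) a where "(a, w) \<in> h" "R x a"
        unfolding T_def by blast
      then show "R b w"
      proof cases
        case a
        then show ?thesis using h1[OF a(1-3) xb] by blast
      next
        case b
        then show ?thesis using hdom xb by blast
      next
        case c
        then show ?thesis using partial_isoD(1)[OF h_iso xb c(1)] by blast
      next
        case d
        then show ?thesis using partial_isoD(2)[OF h_iso xb d(1)] by blast
      qed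
    qed (use xb in \<open>auto simp: T_def\<close>)
    show "T x w \<longleftrightarrow> R x a" if aw: "(a, w) \<in> h" for x a w
    proof
      assume "T x w"
      then consider (a) k' v' u' where "k' \<in> K" "(x, v') \<in> P k'" "(k' w, u') \<in> P k'" "R (f v') u'"
        | (b) k' where "k' \<in> K" "k' w \<notin> Domain (P k')"
        | (c) b' where "(x, b') \<in> h" "R b' w" | (d) a' where "(a', w) \<in> h" "R x a'"
        unfolding T_def by blast
      then show "R x a"
      proof cases
        case a
        then show ?thesis using h2[OF a(1-3) aw] by blast
      next
        case b
        then show ?thesis using hran aw by blast
      next
        case c
        then show ?thesis using partial_isoD(2)[OF h_iso c(1) aw] by blast
      next
        case d
        then show ?thesis using partial_isoD(1)[OF h_iso aw d(1)] by blast
      qed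
    qed (use aw in \<open>auto simp: T_def\<close>)
  qed
qed

section \<open>Adding a point to all domains\<close>

text \<open>The image \<open>v\<close> of \<open>z\<close> needs prescribed relations to three kinds
  of points: elements of the range, their images under \<open>f\<close>, and their preimages, as
  \<open>R (f v) u\<close> is a condition on \<open>v\<close> and \<open>inv_map f u\<close>. One
  point may be of several kinds; the prescriptions agree because an overlap of the range with either
  other kind produces an entry of \<open>h\<close>, along which \<open>T\<close> is known.\<close>

lemma new_orbit_point:
  assumes k: "k \<in> K"
    and T1: "\<And>x v w u. \<lbrakk>(x, v) \<in> P k; (k w, u) \<in> P k\<rbrakk> \<Longrightarrow> T x w \<longleftrightarrow> R (f v) u"
    and T3: "\<And>x b w. (x, b) \<in> h \<Longrightarrow> T x w \<longleftrightarrow> R b w"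
    and T4: "\<And>a w x. (a, w) \<in> h \<Longrightarrow> T x w \<longleftrightarrow> R x a"
  shows "\<exists>v. (\<forall>d e. (d, e) \<in> P k \<longrightarrow> (R e v \<longleftrightarrow> R d z) \<and> \<not> same_orbit f e v) \<and>
    (\<forall>x x' w. (x, x') \<in> P k \<longrightarrow> k w = z \<longrightarrow> (R (f x') v \<longleftrightarrow> T x w)) \<and>
    (\<forall>w u. (k w, u) \<in> P k \<longrightarrow> (R (f v) u \<longleftrightarrow> T z w)) \<and>
    (R (f v) v \<longleftrightarrow> \<epsilon> {e \<in> F. R e z})"
proof -
  define A where "A = Range (P k)"
  define M where "M = A \<union> f ` A \<union> inv_map f ` A"
  obtain w0 where w0: "k w0 = z" using K_surj[OF k] by blast
  define \<tau> where "\<tau> m \<longleftrightarrow> (\<exists>d. (d, m) \<in> P k \<and> R d z) \<or> (\<exists>x x'. (x, x') \<in> P k \<and> m = f x' \<and> T x w0) \<or>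
    (\<exists>w. (k w, f m) \<in> P k \<and> T z w)" for m
  have ab: "T x w0 \<longleftrightarrow> R d z" if d: "(d, f x') \<in> P k" "(x, x') \<in> P k" for d x x'
  proof -
    obtain b where b: "k b = d" using K_surj[OF k] by blast
    then have "(x, b) \<in> h" using P_back[OF k d(2)] d(1) by blast
    then have "T x w0 \<longleftrightarrow> R b w0" by (rule T3)
    then show ?thesis using K_R[OF k, of b w0] b w0 by simp
  qed
  have ac: "T z w \<longleftrightarrow> R d z" if d: "(d, m) \<in> P k" "(k w, f m) \<in> P k" for d m w
    using T4[OF P_back[OF k d]] R_sym by blast
  have bc: "T z w \<longleftrightarrow> T x w0" if d: "(x, x') \<in> P k" "(k w, f (f x')) \<in> P k" for x x' w
  proof -
    \<comment> \<open>Convexity enters here: with \<open>x'\<close> and \<open>f (f x')\<close> the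
      range contains \<open>f x'\<close>, which reduces this overlap to the previous two.\<close>
    have "f x' \<in> Range (P k)"
      using P_convex[OF k, of x' 2 1] d by (auto simp: numeral_2_eq_2)
    then obtain y where y: "(y, f x') \<in> P k" by blast
    show ?thesis using ab[OF y d(1)] ac[OF y d(2)] by blast
  qed
  have a: "\<tau> e \<longleftrightarrow> R d z" if d: "(d, e) \<in> P k" for d e
  proof
    assume "\<tau> e"
    then consider d' where "(d', e) \<in> P k" "R d' z"
      | x x' where "(x, x') \<in> P k" "e = f x'" "T x w0" | w where "(k w, f e) \<in> P k" "T z w"
      unfolding \<tau>_def by blast
    then show "R d z"
      by cases (use d P_inj[OF k d] ab ac in blast)+
  qed (use d in \<open>auto simp: \<tau>_def\<close>)
  have b: "\<tau> (f x') \<longleftrightarrow> T x w0" if x: "(x, x') \<in> P k" for x x'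
  proof
    assume "\<tau> (f x')"
    then consider d where "(d, f x') \<in> P k" "R d z"
      | y y' where "(y, y') \<in> P k" "f x' = f y'" "T y w0" | w where "(k w, f (f x')) \<in> P k" "T z w"
      unfolding \<tau>_def by blast
    then show "T x w0"
    proof cases
      case 2
      then show ?thesis using P_inj[OF k x] f_inj by metis
    qed (use x ab bc in blast)+
  qed (use x in \<open>auto simp: \<tau>_def\<close>)
  have c: "\<tau> m \<longleftrightarrow> T z w" if w: "(k w, f m) \<in> P k" for w m
  proof
    assume "\<tau> m"
    then consider d where "(d, m) \<in> P k" "R d z"
      | x x' where "(x, x') \<in> P k" "m = f x'" "T x w0" | w' where "(k w', f m) \<in> P k" "T z w'"
      unfolding \<tau>_def by blast
    then show "T z w"
    proof cases
      case 3
      then show ?thesis using P_inj[OF k w] K_inj[OF k] by metis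
    qed (use w ac bc in blast)+
  qed (use w in \<open>auto simp: \<tau>_def\<close>)
  have "finite M" unfolding M_def A_def using finite_Range_P[OF k] by simp
  moreover have "F \<subseteq> M" using P_F[OF k] unfolding M_def A_def by blast
  ultimately obtain v where v: "\<forall>m\<in>M. (R m v \<longleftrightarrow> \<tau> m) \<and> \<not> same_orbit f m v"
    and bit: "R (f v) v \<longleftrightarrow> \<epsilon> {e \<in> F. \<tau> e}"
    using extension by blast
  have "{e \<in> F. \<tau> e} = {e \<in> F. R e z}" using a P_F[OF k] by blast
  moreover have "R (f v) u \<longleftrightarrow> T z w" if "(k w, u) \<in> P k" for w u
  proof -
    define m where "m = inv_map f u"
    have fm: "f m = u" unfolding m_def using f_bij by (simp add: bij_is_surj surj_f_inv_f)
    have "m \<in> M" unfolding M_def A_def m_def using that by blast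
    then have "R m v \<longleftrightarrow> T z w" using v c[of w m] that fm by blast
    then show ?thesis using f_R[of v m] fm R_sym by metis
  qed
  moreover have "(R e v \<longleftrightarrow> R d z) \<and> \<not> same_orbit f e v" if "(d, e) \<in> P k" for d e
  proof -
    have "e \<in> M" unfolding M_def A_def using that by blast
    then show ?thesis using v a[OF that] by blast
  qed
  moreover have "R (f x') v \<longleftrightarrow> T x w" if "(x, x') \<in> P k" "k w = z" for x x' w
  proof -
    have "f x' \<in> M" unfolding M_def A_def using that by blast
    moreover have "w = w0" using that w0 K_inj[OF k] by metis
    ultimately show ?thesis using v b[OF that(1)] by blast
  qed
  ultimately show ?thesis using bit by (intro exI[of _ v]) simp
qed

text \<open>All values \<open>R (f v) u\<close> at the new stage are equal to \<open>T x w\<close>,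
  which does not depend on \<open>k\<close>; coherence is then automatic.\<close>

lemma add_point:
  "\<exists>P'. conjugation_state R f F \<epsilon> K h P' \<and> (\<forall>k\<in>K. P k \<subseteq> P' k) \<and> (\<forall>k\<in>K. z \<in> Domain (P' k))"
proof -
  obtain T where T: "\<And>k x v w u. \<lbrakk>k \<in> K; (x, v) \<in> P k; (k w, u) \<in> P k\<rbrakk> \<Longrightarrow> T x w \<longleftrightarrow> R (f v) u"
    "\<And>k w. \<lbrakk>k \<in> K; k w \<notin> Domain (P k)\<rbrakk> \<Longrightarrow> T (k w) w \<longleftrightarrow> \<epsilon> {e \<in> F. R e w}"
    "\<And>x b w. (x, b) \<in> h \<Longrightarrow> T x w \<longleftrightarrow> R b w"
    "\<And>a w x. (a, w) \<in> h \<Longrightarrow> T x w \<longleftrightarrow> R x a"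
    by (rule promise) (blast intro: that)
  define Q where "Q k v \<longleftrightarrow>
    (\<forall>d e. (d, e) \<in> P k \<longrightarrow> (R e v \<longleftrightarrow> R d z) \<and> \<not> same_orbit f e v) \<and>
    (\<forall>x x' w. (x, x') \<in> P k \<longrightarrow> k w = z \<longrightarrow> (R (f x') v \<longleftrightarrow> T x w)) \<and>
    (\<forall>w u. (k w, u) \<in> P k \<longrightarrow> (R (f v) u \<longleftrightarrow> T z w)) \<and>
    (R (f v) v \<longleftrightarrow> \<epsilon> {e \<in> F. R e z})" for k v
  \<comment> \<open>\<open>V k\<close> depends on \<open>k\<close> only through the predicate
    \<open>Q k\<close>, so automorphisms with the same \<open>Q\<close> choose the same image; this
    preserves \<open>local_dep\<close>.\<close>
  define V where "V k = (SOME v. Q k v)" for k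
  have Q: "Q k (V k)" if "k \<in> K" for k
    unfolding V_def Q_def
    by (rule someI_ex, rule new_orbit_point[OF that T(1)[OF that] T(3,4)])
  define P' where "P' k = (if k \<in> K \<and> z \<notin> Domain (P k) then insert (z, V k) (P k) else P k)" for k
  have sub: "P k \<subseteq> P' k" for k by (auto simp: P'_def)
  have cases: "(x, v) \<in> P k \<or> x = z \<and> v = V k \<and> z \<notin> Domain (P k)" if "(x, v) \<in> P' k" for x v k
    using that by (auto simp: P'_def split: if_splits)
  have main: "R (f v) u \<longleftrightarrow> T x w" if k: "k \<in> K" and x: "(x, v) \<in> P' k" and w: "(k w, u) \<in> P' k" for k x v w u
  proof -
    from Q[OF k] have Qk: "\<And>x x' w. (x, x') \<in> P k \<Longrightarrow> k w = z \<Longrightarrow> (R (f x') (V k) \<longleftrightarrow> T x w)"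
      "\<And>w u. (k w, u) \<in> P k \<Longrightarrow> (R (f (V k)) u \<longleftrightarrow> T z w)"
      "R (f (V k)) (V k) \<longleftrightarrow> \<epsilon> {e \<in> F. R e z}"
      unfolding Q_def by blast+
    \<comment> \<open>The diagonal case \<open>x = z = k w\<close> asks for
      \<open>R (f (V k)) (V k)\<close>, which only \<open>\<epsilon>\<close> controls. It matches
      \<open>T\<close> because \<open>k\<close> fixes \<open>F\<close>, so \<open>w\<close> and
      \<open>z\<close> have the same type over \<open>F\<close>.\<close>
    have "{e \<in> F. R e w} = {e \<in> F. R e z}" if "k w = z"
      using K_R[OF k] K_fix[OF k] that by metis
    then have Tz: "T z w \<longleftrightarrow> \<epsilon> {e \<in> F. R e z}" if "k w = z" "z \<notin> Domain (P k)"
      using T(2)[OF k, of w] that by simp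
    from cases[OF x] show ?thesis
    proof
      assume x: "(x, v) \<in> P k"
      from cases[OF w] show ?thesis
        using T(1)[OF k x] Qk(1)[OF x] by blast
    next
      assume x: "x = z \<and> v = V k \<and> z \<notin> Domain (P k)"
      from cases[OF w] show ?thesis
        using Qk(2,3) Tz x by blast
    qed
  qed
  have "conjugation_state R f F \<epsilon> K h P'"
  proof (unfold_locales)
    show "partial_iso R h" by (rule h_iso)
    show "(e, f e) \<in> h" if "e \<in> F" for e using h_F that by blast
    show "partial_conjugator R f F h k (P' k)" if k: "k \<in> K" for k
    proof (cases "z \<in> Domain (P k)")
      case True
      then show ?thesis using lifts[OF k] by (simp add: P'_def)
    next
      case False
      have Qk: "R d z \<longleftrightarrow> R e (V k)" "\<not> same_orbit f e (V k)" if "(d, e) \<in> P k" for d e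
        using Q[OF k] that unfolding Q_def by simp_all
      have "partial_conjugator R f F h k (insert (z, V k) (P k))"
        using Qk by (intro partial_conjugator_insert_new[OF lifts[OF k] False]) blast+
      then show ?thesis using False k by (simp add: P'_def)
    qed
    show "R (f v) u \<longleftrightarrow> R (f v') u'"
      if "k \<in> K" "k' \<in> K" "(x, v) \<in> P' k" "(k w, u) \<in> P' k" "(x, v') \<in> P' k'" "(k' w, u') \<in> P' k'"
      for k k' x w v u v' u'
      using main[OF that(1,3,4)] main[OF that(2,5,6)] by blast
    show "R (f v) u \<longleftrightarrow> \<epsilon> {e \<in> F. R e w}"
      if "k \<in> K" "k' \<in> K" "(k' w, v) \<in> P' k" "(k w, u) \<in> P' k" "k' w \<notin> Domain (P' k')" for k k' w v u
      using main[OF that(1,3,4)] T(2)[OF that(2), of w] that(5) sub by blast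
    have "(\<Union>k\<in>K. Domain (P' k)) \<subseteq> insert z points"
      using cases pointsI by blast
    then show "finite (\<Union>k\<in>K. Domain (P' k))"
      using finite_points finite_subset by blast
    obtain E where E: "finite E" "\<And>k k'. k \<in> K \<Longrightarrow> k' \<in> K \<Longrightarrow> \<forall>e\<in>E. k e = k' e \<Longrightarrow> P k = P k'"
      using local_dep by blast
    \<comment> \<open>Given \<open>P k\<close>, the predicate \<open>Q k\<close> sees
      \<open>k\<close> only at those \<open>w\<close> with \<open>k w\<close> equal to
      \<open>z\<close> or in a domain, so these preimages are added to \<open>E\<close>.\<close>
    define E' where "E' = E \<union> pull (insert z points)"
    have "P' k = P' k'" if k: "k \<in> K" "k' \<in> K" "\<forall>e\<in>E'. k e = k' e" for k k'
    proof -
      have P: "P k = P k'" using E(2)[OF k(1,2)] k(3) by (simp add: E'_def)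
      have agree: "k w = k' w" if "k w \<in> insert z points \<or> k' w \<in> insert z points" for w
      proof -
        have "w \<in> E'" using that k by (auto simp: E'_def pull_iff)
        then show ?thesis using k(3) by blast
      qed
      have z: "k w = z \<longleftrightarrow> k' w = z" for w using agree[of w] by auto
      have w: "(k w, u) \<in> P k \<longleftrightarrow> (k' w, u) \<in> P k" for w u
        using agree[of w] pointsI[OF k(1), of "k w" u] pointsI[OF k(2), of "k' w" u] P
        by (metis insertI2)
      have "Q k = Q k'"
        unfolding Q_def fun_eq_iff P[symmetric] using w z by simp
      then have "V k = V k'" by (simp add: V_def)
      then show ?thesis using P k by (simp add: P'_def)
    qed
    moreover have "finite E'"
      unfolding E'_def using E(1) finite_points by (simp add: finite_pull)
    ultimately show "\<exists>E. finite E \<and> (\<forall>k\<in>K. \<forall>k'\<in>K. (\<forall>e\<in>E. k e = k' e) \<longrightarrow> P' k = P' k')"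
      by blast
  qed
  moreover have "\<forall>k\<in>K. z \<in> Domain (P' k)" by (auto simp: P'_def)
  ultimately show ?thesis using sub by blast
qed

end

context twisting
begin

section \<open>Prolonging and inverting partial conjugators\<close>

text \<open>If \<open>f x'\<close> were in the range, its partner would be some \<open>k b\<close>,
  and the converse clause would put \<open>x\<close> into the domain of \<open>h\<close>. By
  convexity no later iterate of \<open>x'\<close> is in the range either, so the new pair prolongs
  the string through \<open>x'\<close> by one point at its end.\<close>

lemma partial_conjugator_insert_forward:
  assumes L: "partial_conjugator R f F h k r" and k: "k \<in> K"
    and x: "(x, x') \<in> r" "x \<notin> Domain h" and F: "F \<subseteq> Domain h"
    and y: "k y \<notin> Domain r"
    and adj: "\<And>d e. (d, e) \<in> r \<Longrightarrow> R d (k y) \<longleftrightarrow> R e (f x')"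
  shows "partial_conjugator R f F (insert (x, y) h) k (insert (k y, f x') r)"
proof -
  note D = partial_conjugatorD[OF L]
  have fx: "f x' \<notin> Range r"
  proof
    assume "f x' \<in> Range r"
    then obtain d where "(d, f x') \<in> r" by blast
    moreover obtain b where "k b = d" using K_surj[OF k] by blast
    ultimately show False using D(3)[OF x(1), of b] x(2) by blast
  qed
  have fx_iter: "(f ^^ n) (f x') \<notin> Range r" for n
  proof
    assume "(f ^^ n) (f x') \<in> Range r"
    then have "(f ^^ Suc n) x' \<in> Range r" by (simp add: funpow_swap1)
    then have "(f ^^ 1) x' \<in> Range r" using D(4)[of x' "Suc n" 1] x(1) by auto
    then show False using fx by simp
  qed
  have "f x' \<notin> F" using D(5)[of "f x'"] fx by auto
  then have fx_per: "(f ^^ n) (f x') = f x' \<Longrightarrow> n = 0" for n using F_iff[of "f x'"] by auto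
  show ?thesis
    unfolding partial_conjugator_def
  proof (intro conjI allI impI ballI)
    show "partial_iso R (insert (k y, f x') r)"
      using D(1) y fx adj by (rule partial_iso_insert[OF sym irrefl])
    show "\<exists>v. (a, v) \<in> insert (k y, f x') r \<and> (k b, f v) \<in> insert (k y, f x') r"
      if "(a, b) \<in> insert (x, y) h" for a b
      using that D(2)[of a b] x(1) by blast
    show "(c, w) \<in> insert (x, y) h"
      if c: "(c, v) \<in> insert (k y, f x') r" and w: "(k w, f v) \<in> insert (k y, f x') r" for c v w
    proof -
      have "v \<noteq> f x'"
      proof
        assume "v = f x'"
        then have "f (f x') = f x'" using w fx_iter[of 1] by auto
        then show False using fx_per[of 1] by simp
      qed
      then have c: "(c, v) \<in> r" using c by blast
      show ?thesis
      proof (cases "(k w, f v) \<in> r")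
        case True
        then show ?thesis using D(3)[OF c] by blast
      next
        case False
        then have "k w = k y" "f v = f x'" using w by blast+
        then have "w = y" "v = x'" using K_inj[OF k] f_inj by auto
        then show ?thesis using partial_isoD(1)[OF D(1) c x(1)] by blast
      qed
    qed
    show "(f ^^ m) u \<in> Range (insert (k y, f x') r)"
      if u: "u \<in> Range (insert (k y, f x') r)" "(f ^^ n) u \<in> Range (insert (k y, f x') r)" "m \<le> n"
      for u m n
    proof (cases "u = f x'")
      case True
      then have "n = 0" using u(2) fx_iter[of n] fx_per[of n] by auto
      then show ?thesis using u by simp
    next
      case False
      then have uR: "u \<in> Range r" using u(1) by blast
      show ?thesis
      proof (cases "(f ^^ n) u \<in> Range r")
        case True
        then show ?thesis using D(4)[OF uR True u(3)] by blast
      next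
        case False
        then have fnu: "(f ^^ n) u = f x'" using u(2) by blast
        show ?thesis
        proof (cases "m = n")
          case True
          then show ?thesis using fnu by blast
        next
          case False
          then obtain j where j: "n = Suc j" "m \<le> j" using u(3) by (cases n) auto
          then have "(f ^^ j) u = x'" using fnu f_inj by simp
          then show ?thesis using D(4)[OF uR _ j(2)] x(1) by blast
        qed
      qed
    qed
    show "(e, e) \<in> insert (k y, f x') r" if "e \<in> F" for e using D(5)[OF that] by blast
  qed
qed

text \<open>If \<open>\<phi> \<circ> k \<circ> h = f \<circ> \<phi>\<close>, then
  \<open>\<psi> = \<phi> \<circ> k\<close> conjugates \<open>inv_map k \<circ> inv_map h\<close> to
  \<open>inv_map f\<close>. The relation in the conclusion is this \<open>\<psi>\<close>; it has the
  same range as \<open>r\<close>.\<close>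

lemma partial_conjugator_inverse:
  assumes L: "partial_conjugator R f F h k r" and k: "k \<in> K"
  shows "partial_conjugator R (inv_map f) F (h\<inverse>) (inv_map k) {(w, u). (k w, u) \<in> r}"
proof -
  note D = partial_conjugatorD[OF L]
  have kk: "k (inv_map k a) = a" for a using K_bij[OF k] by (simp add: bij_is_surj surj_f_inv_f)
  have ff: "f (inv_map f a) = a" "inv_map f (f a) = a" for a
    using f_bij by (simp_all add: bij_is_surj surj_f_inv_f bij_is_inj)
  have Ran: "Range {(w, u). (k w, u) \<in> r} = Range r"
    using K_surj[OF k] by (auto simp: Range_iff) metis
  show ?thesis
    unfolding partial_conjugator_def Ran
  proof (intro conjI allI impI ballI)
    show "partial_iso R {(w, u). (k w, u) \<in> r}"
      unfolding partial_iso_def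
    proof (intro allI impI)
      fix a b a' b' assume "(a, b) \<in> {(w, u). (k w, u) \<in> r}" "(a', b') \<in> {(w, u). (k w, u) \<in> r}"
      then have "(k a, b) \<in> r" "(k a', b') \<in> r" by auto
      then show "(a = a' \<longleftrightarrow> b = b') \<and> (R a a' \<longleftrightarrow> R b b')"
        using partial_isoD[OF D(1)] K_inj[OF k] K_R[OF k] by metis
    qed
    show "\<exists>v. (b, v) \<in> {(w, u). (k w, u) \<in> r} \<and> (inv_map k a, inv_map f v) \<in> {(w, u). (k w, u) \<in> r}"
      if ba: "(b, a) \<in> h\<inverse>" for b a
    proof -
      obtain v where v: "(a, v) \<in> r" "(k b, f v) \<in> r" using D(2)[of a b] ba by auto
      then show ?thesis by (intro exI[of _ "f v"]) (simp add: ff kk)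
    qed
    show "(w, w') \<in> h\<inverse>"
      if "(w, u) \<in> {(w, u). (k w, u) \<in> r}" "(inv_map k w', inv_map f u) \<in> {(w, u). (k w, u) \<in> r}" for w u w'
      using D(3)[of w' "inv_map f u" w] that by (simp add: ff kk)
    show "(inv_map f ^^ m) u \<in> Range r"
      if u: "u \<in> Range r" "(inv_map f ^^ n) u \<in> Range r" "m \<le> n" for u m n
    proof -
      define v where "v = (inv_map f ^^ n) u"
      then have "(f ^^ n) v = u" using funpow_inv_map[OF f_bij, of n u v] by simp
      then have "(f ^^ m) ((f ^^ (n - m)) v) = u"
        using u(3) by (metis comp_apply funpow_add le_add_diff_inverse)
      then have "(inv_map f ^^ m) u = (f ^^ (n - m)) v"
        using funpow_inv_map[OF f_bij] by metis
      then show ?thesis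
        using D(4)[of v n "n - m"] u \<open>(f ^^ n) v = u\<close> v_def by simp
    qed
    show "(e, e) \<in> {(w, u). (k w, u) \<in> r}" if "e \<in> F" for e
      using D(5)[OF that] K_fix[OF k that] by simp
  qed
qed

text \<open>Inversion swaps \<open>finite_image\<close> with \<open>finite_preimage\<close> and
  leaves orbits and \<open>F\<close> alone. The same \<open>\<epsilon>\<close> serves, since
  applying \<open>f\<close> turns \<open>R (inv_map f v) v\<close> into
  \<open>R v (f v)\<close>.\<close>

lemma twisting_inverse: "twisting R (inv_map f) F \<epsilon> (inv_map ` K)"
proof unfold_locales
  show "symp R" "irreflp R" "finite F" "inv_map ` K \<noteq> {}"
    using sym irrefl finite_F K_nonempty by auto
  show "inv_map f \<in> carrier (graph_aut R)" "inv_map ` K \<subseteq> carrier (graph_aut R)"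
    using inv_map_graph_aut f_aut K_aut by blast+
  show "x \<in> F \<longleftrightarrow> (\<exists>n>0. (inv_map f ^^ n) x = x)" for x
    using F_iff[of x] by (simp add: funpow_inv_map[OF f_bij])
  have bit: "R (inv_map f v) v \<longleftrightarrow> R (f v) v" for v
    using f_R[of "inv_map f v" v] f_bij R_sym by (metis bij_is_surj surj_f_inv_f)
  show "\<exists>v. (\<forall>w\<in>M. (R w v \<longleftrightarrow> \<tau> w) \<and> \<not> same_orbit (inv_map f) w v) \<and>
      (R (inv_map f v) v \<longleftrightarrow> \<epsilon> {e \<in> F. \<tau> e})" if "finite M" "F \<subseteq> M" for M \<tau>
    using extension[OF that, of \<tau>] by (simp add: bit same_orbit_inv_map[OF f_bij])
  have inv_eq: "inv_map k x = y \<longleftrightarrow> k y = x" if "k \<in> K" for k x y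
    using K_bij[OF that] by (metis bij_inv_eq_iff)
  show "k e = e" if "k \<in> inv_map ` K" "e \<in> F" for k e
    using that K_fix inv_eq by auto
  have eq: "(\<exists>k\<in>inv_map ` K. k x = w) \<longleftrightarrow> (\<exists>k\<in>K. k w = x)" for x w
    by (simp add: inv_eq cong: bex_cong)
  have "{k x |k. k \<in> inv_map ` K} = {w. \<exists>k\<in>K. k w = x}" for x
    unfolding eq[symmetric] by blast
  then show "finite {k x |k. k \<in> inv_map ` K}" for x using finite_preimage by simp
  have "{w. \<exists>k\<in>inv_map ` K. k w = x} = {k x |k. k \<in> K}" for x
    unfolding eq by blast
  then show "finite {w. \<exists>k\<in>inv_map ` K. k w = x}" for x using finite_image by simp
qed

end

section \<open>Making \<open>h\<close> total and onto\<close>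

text \<open>The family from \<open>partial_conjugator_inverse\<close>, indexed by inverses: the
  argument \<open>k\<close> is itself the inverse of an element of \<open>K\<close>, and
  \<open>inv_map k\<close> recovers that element.\<close>

definition inverse_lifts :: "(('v \<Rightarrow> 'v) \<Rightarrow> ('v \<times> 'v) set) \<Rightarrow> ('v \<Rightarrow> 'v) \<Rightarrow> ('v \<times> 'v) set" where
  "inverse_lifts P k = {(w, u). (inv_map k w, u) \<in> P (inv_map k)}"

context conjugation_state
begin

text \<open>The value \<open>y = h x\<close> is given the type \<open>T x\<close> over all points
  that matter and codes them at the same time. Being outside \<open>W\<close> and
  \<open>pull (push W)\<close>, it makes every \<open>k y\<close> a fresh point that no
  \<open>k'\<close> reaches from \<open>W\<close>.\<close>

lemma forward:
  assumes xP: "\<And>k. k \<in> K \<Longrightarrow> x \<in> Domain (P k)"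
  shows "\<exists>h' P'. conjugation_state R f F \<epsilon> K h' P' \<and> h \<subseteq> h' \<and> (\<forall>k\<in>K. P k \<subseteq> P' k) \<and> x \<in> Domain h'"
proof (cases "x \<in> Domain h")
  case True
  then show ?thesis using conjugation_state_axioms by blast
next
  case False
  obtain T where T1: "\<And>k x v w u. \<lbrakk>k \<in> K; (x, v) \<in> P k; (k w, u) \<in> P k\<rbrakk> \<Longrightarrow> T x w \<longleftrightarrow> R (f v) u"
    and T4: "\<And>a w x. (a, w) \<in> h \<Longrightarrow> T x w \<longleftrightarrow> R x a"
    by (rule promise) (blast intro: that)
  \<comment> \<open>\<open>local_dep\<close> turns the equality of \<open>P k\<close> and
    \<open>P k'\<close> into agreement on a finite set, which \<open>y\<close> can then code
    together with \<open>W\<close>.\<close>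
  obtain E where E: "finite E" "\<And>k k'. k \<in> K \<Longrightarrow> k' \<in> K \<Longrightarrow> \<forall>e\<in>E. k e = k' e \<Longrightarrow> P k = P k'"
    using local_dep by blast
  define W where "W = pull points"
  have fin: "finite W" "finite (W \<union> E)" "finite (W \<union> pull (push W))"
    unfolding W_def using E(1) finite_points by (simp_all add: finite_pull finite_push)
  obtain y where y_new: "y \<notin> W \<union> pull (push W)"
    and y_type: "\<And>w. w \<in> W \<union> E \<Longrightarrow> R w y \<longleftrightarrow> T x w"
    and split: "\<And>k k' w. k \<in> K \<Longrightarrow> k' \<in> K \<Longrightarrow> k y = k' y \<Longrightarrow> w \<in> W \<union> E \<Longrightarrow> k w = k' w"
    using splitting_extension[OF fin(2,3), of "\<lambda>w. T x w"] by metis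
  have FD: "F \<subseteq> Domain h" using h_F by blast
  have ky: "k y \<notin> points" if "k \<in> K" for k
    using y_new that by (auto simp: W_def pull_iff)
  have yW: "y \<notin> W" using y_new by blast
  have no_return: "k' w \<noteq> k y" if "k \<in> K" "k' \<in> K" "w \<in> W" for k k' w
    using y_new that by (auto simp: pull_iff push_iff)
  have Wr: "w \<in> W" if "k \<in> K" "(k w, u) \<in> P k" for k w u
    using pull_pointsI that unfolding W_def by blast
  define X where "X k = (SOME v. (x, v) \<in> P k)" for k
  have X: "(x, X k) \<in> P k" if "k \<in> K" for k
    unfolding X_def using xP[OF that] by (auto intro: someI)
  define h' where "h' = insert (x, y) h"
  define P' where "P' k = insert (k y, f (X k)) (P k)" for k
  have P_eq: "P k = P k'" if "k \<in> K" "k' \<in> K" "k y = k' y" for k k'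
    using E(2)[OF that(1,2)] split[OF that] by blast
  have X_eq: "X k = X k'" if "k \<in> K" "k' \<in> K" "k y = k' y" for k k'
    using P_eq[OF that] by (simp add: X_def)
  have old: "(c, v) \<in> P k" if "(c, v) \<in> P' k" "c \<noteq> k y" for c v k
    using that by (simp add: P'_def)
  have new: "v = f (X k)" if "(k y, v) \<in> P' k" "k \<in> K" for v k
    using that pointsI[OF that(2), of "k y" v] ky[OF that(2)] by (auto simp: P'_def)
  have adj: "R d (k y) \<longleftrightarrow> R e (f (X k))" if k: "k \<in> K" "(d, e) \<in> P k" for d e k
  proof -
    obtain w where w: "k w = d" using K_surj[OF k(1)] by blast
    have "R d (k y) \<longleftrightarrow> R w y" using w K_R[OF k(1)] by blast
    also have "\<dots> \<longleftrightarrow> T x w" using y_type[of w] Wr[of k w e] k w by auto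
    also have "\<dots> \<longleftrightarrow> R (f (X k)) e" using T1[OF k(1) X[OF k(1)]] k w by blast
    finally show ?thesis using R_sym by blast
  qed
  have "conjugation_state R f F \<epsilon> K h' P'"
  proof unfold_locales
    show "partial_iso R h'"
      unfolding h'_def
    proof (rule partial_iso_insert[OF sym irrefl h_iso False])
      obtain k where k: "k \<in> K" using K_nonempty by blast
      have bW: "b \<in> W" if "(a, b) \<in> h" for a b
        using P_h[OF k that] Wr[OF k] by metis
      then show "y \<notin> Range h" using yW by blast
      show "R d x \<longleftrightarrow> R e y" if "(d, e) \<in> h" for d e
        using y_type[of e] bW[OF that] T4[OF that, of x] R_sym by blast
    qed
    show "(e, f e) \<in> h'" if "e \<in> F" for e using h_F[OF that] by (simp add: h'_def)
    show "partial_conjugator R f F h' k (P' k)" if k: "k \<in> K" for k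
    proof -
      have "k y \<notin> Domain (P k)" using ky[OF k] pointsI[OF k] by blast
      then show ?thesis
        unfolding h'_def P'_def
        using partial_conjugator_insert_forward[OF lifts[OF k] k X[OF k] False FD] adj[OF k] by blast
    qed
    show "R (f v) u \<longleftrightarrow> R (f v') u'"
      if k: "k \<in> K" "k' \<in> K" and v: "(c, v) \<in> P' k" and u: "(k w, u) \<in> P' k"
        and v': "(c, v') \<in> P' k'" and u': "(k' w, u') \<in> P' k'" for k k' c w v u v' u'
    proof (cases "c \<in> points")
      case True
      then have c: "(c, v) \<in> P k" "(c, v') \<in> P k'" using old v v' ky k by metis+
      show ?thesis
      proof (cases "w = y")
        case True
        \<comment> \<open>Both sides reduce to \<open>R c x\<close>, whatever \<open>k\<close> and
          \<open>k'\<close> are.\<close>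
        then have "u = f (X k)" "u' = f (X k')" using new u u' k by blast+
        then show ?thesis
          using P_R[OF k(1) c(1) X[OF k(1)]] P_R[OF k(2) c(2) X[OF k(2)]] by (simp add: f_R)
      next
        case False
        then have "(k w, u) \<in> P k" "(k' w, u') \<in> P k'" using old u u' k K_inj by metis+
        then show ?thesis using coherent[OF k c(1) _ c(2)] by blast
      qed
    next
      case False
      then have c: "c = k y" "c = k' y" using old v v' pointsI k by metis+
      \<comment> \<open>Here \<open>c\<close> is fresh for both; by the splitting property
        \<open>k\<close> and \<open>k'\<close> have the same lifts and agree on
        \<open>W\<close>.\<close>
      then have eq: "k y = k' y" by simp
      have "v = f (X k)" using new[OF _ k(1), of v] v c(1) by metis
      moreover have "v' = f (X k')" using new[OF _ k(2), of v'] v' c(2) by metis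
      moreover
      have "u = u'"
      proof (cases "w = y")
        case True
        then have "u = f (X k)" "u' = f (X k')" using new u u' k by blast+
        then show ?thesis using X_eq[OF k eq] by simp
      next
        case False
        then have kw: "(k w, u) \<in> P k" "(k' w, u') \<in> P k'" using old u u' k K_inj by metis+
        then have "k w = k' w" using split[OF k eq, of w] Wr[OF k(1)] by blast
        then show ?thesis using kw P_eq[OF k eq] P_inj[OF k(2)] by metis
      qed
      ultimately show ?thesis using X_eq[OF k eq] by simp
    qed
    show "R (f v) u \<longleftrightarrow> \<epsilon> {e \<in> F. R e w}"
      if k: "k \<in> K" "k' \<in> K" and v: "(k' w, v) \<in> P' k" and u: "(k w, u) \<in> P' k"
        and n: "k' w \<notin> Domain (P' k')" for k k' w v u
    proof -
      \<comment> \<open>A fresh point can play neither part: \<open>w = y\<close> would put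
        \<open>k' w\<close> into \<open>Domain (P' k')\<close>, and \<open>k' w = k y\<close> is
        excluded by \<open>no_return\<close>. So the old \<open>new_type\<close> applies.\<close>
      have wy: "w \<noteq> y" using n by (auto simp: P'_def)
      then have u: "(k w, u) \<in> P k" using old u k K_inj by metis
      then have "k' w \<noteq> k y" using no_return k Wr by metis
      then have v: "(k' w, v) \<in> P k" using old v by blast
      show ?thesis using new_type[OF k v u] n by (auto simp: P'_def)
    qed
    have "(\<Union>k\<in>K. Domain (P' k)) \<subseteq> push {y} \<union> points"
    proof
      fix z assume "z \<in> (\<Union>k\<in>K. Domain (P' k))"
      then obtain k v where k: "k \<in> K" "(z, v) \<in> P' k" by blast
      show "z \<in> push {y} \<union> points"
      proof (cases "z = k y")
        case True
        then show ?thesis using k(1) by (auto simp: push_def)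
      next
        case False
        then show ?thesis using old[OF k(2)] pointsI[OF k(1)] by blast
      qed
    qed
    moreover have "finite (push {y} \<union> points)" using finite_points by (simp add: finite_push)
    ultimately show "finite (\<Union>k\<in>K. Domain (P' k))" by (rule finite_subset)
    \<comment> \<open>The single point \<open>y\<close> now replaces \<open>E\<close>, because
      agreement at \<open>y\<close> was made to imply agreement on everything used.\<close>
    have "P' k = P' k'" if "k \<in> K" "k' \<in> K" "k y = k' y" for k k'
      unfolding P'_def using P_eq[OF that] X_eq[OF that] that by simp
    then have "finite {y} \<and> (\<forall>k\<in>K. \<forall>k'\<in>K. (\<forall>e\<in>{y}. k e = k' e) \<longrightarrow> P' k = P' k')"
      by blast
    then show "\<exists>E. finite E \<and> (\<forall>k\<in>K. \<forall>k'\<in>K. (\<forall>e\<in>E. k e = k' e) \<longrightarrow> P' k = P' k')"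
      by (rule exI)
  qed
  moreover have "h \<subseteq> h'" "\<forall>k\<in>K. P k \<subseteq> P' k" "x \<in> Domain h'"
    unfolding h'_def P'_def by blast+
  ultimately show ?thesis by blast
qed

lemma inverse_lifts_iff:
  "k \<in> K \<Longrightarrow> (w, u) \<in> inverse_lifts P (inv_map k) \<longleftrightarrow> (k w, u) \<in> P k"
  using K_bij by (simp add: inverse_lifts_def inv_inv_eq)

text \<open>The conditions are self-dual: \<open>R (inv_map f v) u\<close> is
  \<open>R (f u) v\<close>, so inversion exchanges the roles of \<open>x\<close> and
  \<open>w\<close> in \<open>coherent\<close>. In \<open>new_type\<close> the point \<open>w\<close>
  turns into \<open>inv_map j' w\<close>, which has the same type over \<open>F\<close>.\<close>

lemma inverse_state:
  "conjugation_state R (inv_map f) F \<epsilon> (inv_map ` K) (h\<inverse>) (inverse_lifts P)"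
proof -
  interpret inverse: twisting R "inv_map f" F \<epsilon> "inv_map ` K"
    by (rule twisting_inverse)
  have kk: "k (inv_map k a) = a" if "k \<in> K" for k a
    using K_bij[OF that] by (simp add: bij_is_surj surj_f_inv_f)
  have flip: "R (inv_map f v) u \<longleftrightarrow> R (f u) v" for u v
    using f_R[of "inv_map f v" u] f_bij R_sym by (metis bij_is_surj surj_f_inv_f)
  note iff = inverse_lifts_iff
  show ?thesis
  proof unfold_locales
    show "partial_iso R (h\<inverse>)"
      using h_iso unfolding partial_iso_def by blast
    show "(e, inv_map f e) \<in> h\<inverse>" if e: "e \<in> F" for e
    proof -
      obtain n where "n > 0" "(inv_map f ^^ n) e = e" using inverse.F_iff[of e] e by auto
      then have "(inv_map f ^^ n) (inv_map f e) = inv_map f e" by (metis funpow_swap1)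
      then have "inv_map f e \<in> F" using \<open>n > 0\<close> inverse.F_iff[of "inv_map f e"] by auto
      then have "(inv_map f e, f (inv_map f e)) \<in> h" by (rule h_F)
      then show ?thesis using f_bij by (simp add: bij_is_surj surj_f_inv_f)
    qed
    show "partial_conjugator R (inv_map f) F (h\<inverse>) k (inverse_lifts P k)" if "k \<in> inv_map ` K" for k
    proof -
      obtain j where j: "j \<in> K" "k = inv_map j" using \<open>k \<in> inv_map ` K\<close> by blast
      then have "inverse_lifts P k = {(w, u). (j w, u) \<in> P j}" using iff by auto
      then show ?thesis using partial_conjugator_inverse[OF lifts[OF j(1)] j(1)] j(2) by simp
    qed
    show "R (inv_map f v) u \<longleftrightarrow> R (inv_map f v') u'"
      if "k \<in> inv_map ` K" "k' \<in> inv_map ` K" "(x, v) \<in> inverse_lifts P k" "(k w, u) \<in> inverse_lifts P k"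
        "(x, v') \<in> inverse_lifts P k'" "(k' w, u') \<in> inverse_lifts P k'" for k k' x w v u v' u'
    proof -
      from that(1,2) obtain j j' where j: "j \<in> K" "k = inv_map j" "j' \<in> K" "k' = inv_map j'"
        by blast
      have "(j x, v) \<in> P j" "(w, u) \<in> P j" "(j' x, v') \<in> P j'" "(w, u') \<in> P j'"
        using that(3-6) j by (auto simp: iff kk)
      then show ?thesis unfolding flip using coherent[OF j(1,3)] by blast
    qed
    show "R (inv_map f v) u \<longleftrightarrow> \<epsilon> {e \<in> F. R e w}"
      if "k \<in> inv_map ` K" "k' \<in> inv_map ` K" "(k' w, v) \<in> inverse_lifts P k" "(k w, u) \<in> inverse_lifts P k"
        "k' w \<notin> Domain (inverse_lifts P k')" for k k' w v u
    proof -
      from that(1,2) obtain j j' where j: "j \<in> K" "k = inv_map j" "j' \<in> K" "k' = inv_map j'"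
        by blast
      define s where "s = inv_map j' w"
      have s: "j' s = w" unfolding s_def using kk j by blast
      have "(j s, v) \<in> P j" "(j' s, u) \<in> P j" "j' s \<notin> Domain (P j')"
        using that(3-5) j s by (auto simp: iff kk s_def Domain_iff)
      then have "R (f u) v \<longleftrightarrow> \<epsilon> {e \<in> F. R e s}" using new_type[OF j(1,3)] by blast
      moreover have "{e \<in> F. R e s} = {e \<in> F. R e w}"
        using K_R[OF j(3)] K_fix[OF j(3)] s by metis
      ultimately show ?thesis unfolding flip by simp
    qed
    have "(\<Union>k\<in>inv_map ` K. Domain (inverse_lifts P k)) \<subseteq> pull points"
      by (auto simp: iff intro: pull_pointsI)
    then show "finite (\<Union>k\<in>inv_map ` K. Domain (inverse_lifts P k))"
      using finite_pull[OF finite_points] by (rule finite_subset)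
    obtain E where E: "finite E" "\<And>k k'. k \<in> K \<Longrightarrow> k' \<in> K \<Longrightarrow> \<forall>e\<in>E. k e = k' e \<Longrightarrow> P k = P k'"
      using local_dep by blast
    \<comment> \<open>Inverses that agree on \<open>push A\<close> come from automorphisms that
      agree on \<open>A\<close>, as \<open>j e\<close> is in \<open>push A\<close> for every
      \<open>e\<close> in \<open>A\<close>.\<close>
    have "inverse_lifts P (inv_map j) = inverse_lifts P (inv_map j')"
      if j: "j \<in> K" "j' \<in> K" and eq: "\<forall>e\<in>push (E \<union> pull points). inv_map j e = inv_map j' e" for j j'
    proof -
      have agree: "j e = j' e" if "e \<in> E \<union> pull points" for e
      proof -
        have "j e \<in> push (E \<union> pull points)" using that j unfolding push_iff by blast
        then have "inv_map j' (j e) = e" using eq K_bij[OF j(1)] by (metis bij_is_inj inv_f_f)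
        then show ?thesis using kk[OF j(2)] by metis
      qed
      then have P: "P j = P j'" using E(2) j by blast
      have "(j w, u) \<in> P j \<longleftrightarrow> (j' w, u) \<in> P j'" for w u
        using agree[of w] pull_pointsI[OF j(1), of w u] pull_pointsI[OF j(2), of w u] P
        by (metis UnI2)
      then show ?thesis using iff j by auto
    qed
    then have "\<forall>k\<in>inv_map ` K. \<forall>k'\<in>inv_map ` K. (\<forall>e\<in>push (E \<union> pull points). k e = k' e) \<longrightarrow>
        inverse_lifts P k = inverse_lifts P k'"
      by blast
    moreover have "finite (push (E \<union> pull points))"
      using E(1) finite_points by (simp add: finite_push finite_pull)
    ultimately show "\<exists>E. finite E \<and> (\<forall>k\<in>inv_map ` K. \<forall>k'\<in>inv_map ` K.
        (\<forall>e\<in>E. k e = k' e) \<longrightarrow> inverse_lifts P k = inverse_lifts P k')"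
      by blast
  qed
qed

text \<open>This is \<open>forward\<close> for the inverse state, where \<open>b\<close> lies in the
  domain of a lift exactly when \<open>k b\<close> lies in \<open>Domain (P k)\<close>. Inverting
  once more returns to \<open>f\<close> and \<open>K\<close>.\<close>

lemma backward:
  assumes bP: "\<And>k. k \<in> K \<Longrightarrow> k b \<in> Domain (P k)"
  shows "\<exists>h' P'. conjugation_state R f F \<epsilon> K h' P' \<and> h \<subseteq> h' \<and> (\<forall>k\<in>K. P k \<subseteq> P' k) \<and> b \<in> Range h'"
proof -
  interpret inverse: conjugation_state R "inv_map f" F \<epsilon> "inv_map ` K" "h\<inverse>" "inverse_lifts P"
    by (rule inverse_state)
  have "b \<in> Domain (inverse_lifts P k)" if "k \<in> inv_map ` K" for k
    using that bP by (auto simp: inverse_lifts_iff Domain_iff)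
  then obtain h2 P2 where 2: "conjugation_state R (inv_map f) F \<epsilon> (inv_map ` K) h2 P2"
    "h\<inverse> \<subseteq> h2" "\<forall>k\<in>inv_map ` K. inverse_lifts P k \<subseteq> P2 k" "b \<in> Domain h2"
    using inverse.forward[of b] by metis
  interpret dual: conjugation_state R "inv_map f" F \<epsilon> "inv_map ` K" h2 P2
    by (rule 2(1))
  have "inv_map ` inv_map ` K = (\<lambda>k. k) ` K"
    unfolding image_image using K_bij by (intro image_cong) (simp_all add: inv_inv_eq)
  then have "inv_map ` inv_map ` K = K" by simp
  then have "conjugation_state R f F \<epsilon> K (h2\<inverse>) (inverse_lifts P2)"
    using dual.inverse_state f_bij by (simp add: inv_inv_eq)
  moreover have "P k \<subseteq> inverse_lifts P2 k" if k: "k \<in> K" for k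
  proof
    fix p assume p: "p \<in> P k"
    obtain x v where xv: "p = (x, v)" by fastforce
    have "k (inv_map k x) = x" using K_bij[OF k] by (simp add: bij_is_surj surj_f_inv_f)
    then have "(inv_map k x, v) \<in> inverse_lifts P (inv_map k)"
      using p xv k by (simp add: inverse_lifts_iff)
    then have "(inv_map k x, v) \<in> P2 (inv_map k)" using 2(3) k by blast
    then show "p \<in> inverse_lifts P2 k" by (simp add: xv inverse_lifts_def)
  qed
  ultimately show ?thesis using 2(2,4) by (intro exI[of _ "h2\<inverse>"] exI[of _ "inverse_lifts P2"]) auto
qed

end

section \<open>Meeting every orbit of \<open>f\<close>\<close>

context conjugation_state
begin

text \<open>Points of the orbit of \<open>u\<close> are hit separately by the \<open>\<phi>\<^sub>k\<close> of one class \<open>C\<close> of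
  automorphisms. If \<open>x\<close> is chosen so that \<open>k\<^sup>-\<^sup>1 x\<close> determines the class of \<open>k\<close>, then the
  uncontrolled value of \<open>R (f u) u\<close> does not interfere with the other classes.\<close>

lemma hit_class:
  assumes k0: "k0 \<in> K" and E: "finite E"
    and C_def: "C = {k \<in> K. \<forall>e\<in>E. k e = k0 e}"
    and PC: "\<And>k. k \<in> C \<Longrightarrow> P k = P k0"
    and EC: "\<And>k w. k \<in> C \<Longrightarrow> k w \<in> Domain (P k0) \<Longrightarrow> w \<in> E"
    and u: "\<And>e. e \<in> Range (P k0) \<Longrightarrow> \<not> same_orbit f e u"
  shows "\<exists>P'. conjugation_state R f F \<epsilon> K h P' \<and> (\<forall>k\<in>K. P k \<subseteq> P' k) \<and>
    (\<forall>k\<in>K. k \<notin> C \<longrightarrow> P' k = P k) \<and> (\<forall>k\<in>C. u \<in> Range (P' k))"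
proof -
  interpret inverse: twisting R "inv_map f" F \<epsilon> "inv_map ` K"
    by (rule twisting_inverse)
  have fin: "finite (points \<union> push E)" "finite (points \<union> push (pull points))"
    using finite_points E by (simp_all add: finite_push finite_pull)
  \<comment> \<open>Splitting is applied to the inverses: \<open>inv_map k x = inv_map k' x\<close>
    forces agreement on \<open>push E\<close>, hence \<open>k\<close> and \<open>k'\<close> agree on
    \<open>E\<close>. The type of \<open>x\<close> copies that of \<open>u\<close> through
    \<open>P k0\<close>, which serves the whole class.\<close>
  obtain x where x_new: "x \<notin> points \<union> push (pull points)"
    and x_type: "\<And>w. w \<in> points \<union> push E \<Longrightarrow> R w x \<longleftrightarrow> (\<exists>e. (w, e) \<in> P k0 \<and> R e u)"
    and x_split: "\<And>k k' w. k \<in> inv_map ` K \<Longrightarrow> k' \<in> inv_map ` K \<Longrightarrow> k x = k' x \<Longrightarrow>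
      w \<in> points \<union> push E \<Longrightarrow> k w = k' w"
    by (rule inverse.splitting_extension[OF fin, of "\<lambda>w. \<exists>e. (w, e) \<in> P k0 \<and> R e u"])
      (rule that, assumption+)
  have inv_eq: "inv_map k a = b \<longleftrightarrow> k b = a" if "k \<in> K" for k a b
    using K_bij[OF that] by (metis bij_inv_eq_iff)
  have CK: "k \<in> K" if "k \<in> C" for k using that C_def by simp
  have split: "k e = k' e" if k: "k \<in> K" "k' \<in> K" "k w = x" "k' w = x" "e \<in> E" for k k' w e
  proof -
    have "inv_map k x = inv_map k' x" using inv_eq k by metis
    moreover have "k e \<in> push E" using k unfolding push_iff by blast
    ultimately have "inv_map k (k e) = inv_map k' (k e)"
      using x_split[of "inv_map k" "inv_map k'" "k e"] k by blast
    then show ?thesis using inv_eq k by metis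
  qed
  have no_return: "k' w \<notin> points" if k: "k \<in> K" "k' \<in> K" "k w = x" for k k' w
  proof
    assume "k' w \<in> points"
    then have "w \<in> pull points" using k(2) by (auto simp: pull_iff)
    then have "x \<in> push (pull points)" using k(1,3) by (auto simp: push_def)
    then show False using x_new by simp
  qed
  define P' where "P' k = (if k \<in> C then insert (x, u) (P k) else P k)" for k
  have sub: "P k \<subseteq> P' k" for k by (auto simp: P'_def)
  have old: "(c, v) \<in> P k" if "(c, v) \<in> P' k" "c \<noteq> x" for c v k
    using that by (auto simp: P'_def split: if_splits)
  have xP: "(x, v) \<notin> P k" if "k \<in> K" for k v
    using x_new pointsI[OF that] by blast
  have new: "k \<in> C \<and> v = u" if "(x, v) \<in> P' k" "k \<in> K" for v k
    using that xP[OF that(2)] by (auto simp: P'_def split: if_splits)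
  have "conjugation_state R f F \<epsilon> K h P'"
  proof unfold_locales
    show "partial_iso R h" by (rule h_iso)
    show "(e, f e) \<in> h" if "e \<in> F" for e using that by (rule h_F)
    show "partial_conjugator R f F h k (P' k)" if k: "k \<in> K" for k
    proof (cases "k \<in> C")
      case True
      have "x \<notin> Domain (P k)" using xP[OF k] by blast
      moreover have "R d x \<longleftrightarrow> R e u" if "(d, e) \<in> P k" for d e
      proof -
        have de: "(d, e) \<in> P k0" using that PC[OF True] by simp
        have "R d x \<longleftrightarrow> (\<exists>e. (d, e) \<in> P k0 \<and> R e u)"
          using x_type pointsI[OF k that] by blast
        then show ?thesis using P_inj[OF k0 de] de by blast
      qed
      moreover have "\<not> same_orbit f e u" if "e \<in> Range (P k)" for e
        using u that PC[OF True] by simp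
      ultimately have "partial_conjugator R f F h k (insert (x, u) (P k))"
        by (rule partial_conjugator_insert_new[OF lifts[OF k]])
      then show ?thesis using True by (simp add: P'_def)
    next
      case False
      then show ?thesis using lifts[OF k] by (simp add: P'_def)
    qed
    show "R (f v) a \<longleftrightarrow> R (f v') a'"
      if k: "k \<in> K" "k' \<in> K" and v: "(c, v) \<in> P' k" and a: "(k w, a) \<in> P' k"
        and v': "(c, v') \<in> P' k'" and a': "(k' w, a') \<in> P' k'" for k k' c w v a v' a'
    proof -
      \<comment> \<open>Since \<open>x\<close> avoids \<open>push (pull points)\<close>, the new
        point occurs as \<open>k w\<close> and as \<open>k' w\<close> at the same time or not at
        all.\<close>
      have same: "k w = x \<longleftrightarrow> k' w = x"
        using no_return[OF k, of w] no_return[OF k(2,1), of w] old[OF a] old[OF a']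
          pointsI[OF k(1)] pointsI[OF k(2)] by blast
      show ?thesis
      proof (cases "c = x")
        case True
        then have C: "k \<in> C" "k' \<in> C" "v = u" "v' = u" using new k v v' by blast+
        have "a = a'"
        proof (cases "k w = x")
          case True
          then show ?thesis using new[of a k] new[of a' k'] a a' k same by metis
        next
          case False
          then have kw: "(k w, a) \<in> P k0" "(k' w, a') \<in> P k0"
            using old[OF a] old[OF a'] same PC[OF C(1)] PC[OF C(2)] by simp_all
          then have "w \<in> E" using EC[OF C(1)] by blast
          then have "k w = k' w" using C(1,2) by (simp add: C_def)
          then show ?thesis using P_inj[OF k0 kw] by simp
        qed
        then show ?thesis using C by simp
      next
        case False
        then have c: "(c, v) \<in> P k" "(c, v') \<in> P k'" using old v v' by blast+
        show ?thesis
        proof (cases "k w = x")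
          case True
          then have "k \<in> C \<and> a = u" "k' \<in> C \<and> a' = u"
            using new[of a k] new[of a' k'] a a' k same by simp_all
          moreover from this have "P k' = P k" using PC[of k] PC[of k'] by simp
          then have "v = v'" using P_inj[OF k(1) c(1)] c(2) by blast
          ultimately show ?thesis by simp
        next
          case False
          then show ?thesis using coherent[OF k c(1) _ c(2)] old[OF a] old[OF a'] same by blast
        qed
      qed
    qed
    show "R (f v) a \<longleftrightarrow> \<epsilon> {e \<in> F. R e w}"
      if k: "k \<in> K" "k' \<in> K" and v: "(k' w, v) \<in> P' k" and a: "(k w, a) \<in> P' k"
        and n: "k' w \<notin> Domain (P' k')" for k k' w v a
    proof (cases "k' w = x")
      case True
      then have kC: "k \<in> C" using new[of v k] v k by simp
      \<comment> \<open>This case is contradictory: \<open>k\<close> and \<open>k'\<close> both send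
        \<open>w\<close> to \<open>x\<close>, so they are in one class by the choice of
        \<open>x\<close>, and \<open>k' w\<close> is not missing from the domain.\<close>
      have "k w = x"
        using no_return[OF k(2,1) True] old[OF a] pointsI[OF k(1)] by blast
      then have "k' \<in> C" using split[OF k _ True] k kC by (simp add: C_def)
      then show ?thesis using n True by (auto simp: P'_def)
    next
      case False
      then have v: "(k' w, v) \<in> P k" using old v by blast
      then have "k w \<noteq> x" using no_return[OF k] pointsI[OF k(1)] by blast
      then have a: "(k w, a) \<in> P k" using old a by blast
      show ?thesis using new_type[OF k v a] n sub by blast
    qed
    have "(\<Union>k\<in>K. Domain (P' k)) \<subseteq> insert x points"
    proof
      fix z assume "z \<in> (\<Union>k\<in>K. Domain (P' k))"
      then obtain k v where k: "k \<in> K" "(z, v) \<in> P' k" by blast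
      then show "z \<in> insert x points" using old[OF k(2)] pointsI[OF k(1)] by blast
    qed
    then show "finite (\<Union>k\<in>K. Domain (P' k))"
      using finite_points finite_subset by blast
    obtain E0 where E0: "finite E0" "\<And>k k'. k \<in> K \<Longrightarrow> k' \<in> K \<Longrightarrow> \<forall>e\<in>E0. k e = k' e \<Longrightarrow> P k = P k'"
      using local_dep by blast
    have "P' k = P' k'" if k: "k \<in> K" "k' \<in> K" "\<forall>e\<in>E0 \<union> E. k e = k' e" for k k'
    proof -
      have "P k = P k'" using E0(2) k by blast
      moreover have "k \<in> C \<longleftrightarrow> k' \<in> C" using k by (simp add: C_def)
      ultimately show ?thesis by (simp add: P'_def)
    qed
    then have "\<forall>k\<in>K. \<forall>k'\<in>K. (\<forall>e\<in>E0 \<union> E. k e = k' e) \<longrightarrow> P' k = P' k'" by blast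
    moreover have "finite (E0 \<union> E)" using E0(1) E by simp
    ultimately show "\<exists>E. finite E \<and> (\<forall>k\<in>K. \<forall>k'\<in>K. (\<forall>e\<in>E. k e = k' e) \<longrightarrow> P' k = P' k')"
      by blast
  qed
  moreover have "\<forall>k\<in>K. k \<notin> C \<longrightarrow> P' k = P k" "\<forall>k\<in>C. u \<in> Range (P' k)"
    by (auto simp: P'_def)
  ultimately show ?thesis using sub by blast
qed

text \<open>\<open>K\<close> falls into finitely many classes according to the values on
  \<open>E\<close>, and these are treated one by one. Including \<open>pull points\<close> in
  \<open>E\<close> makes the members of a class agree wherever they reach a domain point.\<close>

lemma hit_orbit:
  "\<exists>P'. conjugation_state R f F \<epsilon> K h P' \<and> (\<forall>k\<in>K. P k \<subseteq> P' k) \<and>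
    (\<forall>k\<in>K. \<exists>e\<in>Range (P' k). same_orbit f e u)"
proof -
  obtain E0 where E0: "finite E0" "\<And>k k'. k \<in> K \<Longrightarrow> k' \<in> K \<Longrightarrow> \<forall>e\<in>E0. k e = k' e \<Longrightarrow> P k = P k'"
    using local_dep by blast
  define E where "E = E0 \<union> pull points"
  have finE: "finite E" unfolding E_def using E0(1) finite_points by (simp add: finite_pull)
  define cls where "cls k = (\<lambda>e. (e, k e)) ` E" for k :: "'v \<Rightarrow> 'v"
  define hit where "hit r \<longleftrightarrow> (\<exists>e\<in>Range r. same_orbit f e u)" for r :: "('v \<times> 'v) set"
  have cls_eq: "cls k = cls k' \<longleftrightarrow> (\<forall>e\<in>E. k e = k' e)" for k k'
    by (auto simp: cls_def image_iff set_eq_iff)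
  have hit_mono: "hit r \<Longrightarrow> r \<subseteq> r' \<Longrightarrow> hit r'" for r r' unfolding hit_def by blast
  \<comment> \<open>Classes outside \<open>S\<close> keep their original \<open>P k\<close>, so that
    it is still constant on the next class, as \<open>hit_class\<close> demands.\<close>
  have step: "\<exists>P'. conjugation_state R f F \<epsilon> K h P' \<and> (\<forall>k\<in>K. P k \<subseteq> P' k) \<and>
      (\<forall>k\<in>K. cls k \<notin> S \<longrightarrow> P' k = P k) \<and> (\<forall>k\<in>K. cls k \<in> S \<longrightarrow> hit (P' k))" if "finite S" for S
    using that
  proof (induction S rule: finite_induct)
    case empty
    show ?case using conjugation_state_axioms by blast
  next
    case (insert c S)
    then obtain P1 where P1: "conjugation_state R f F \<epsilon> K h P1" "\<forall>k\<in>K. P k \<subseteq> P1 k"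
      "\<forall>k\<in>K. cls k \<notin> S \<longrightarrow> P1 k = P k" "\<forall>k\<in>K. cls k \<in> S \<longrightarrow> hit (P1 k)"
      by blast
    show ?case
    proof (cases "\<exists>k\<in>K. cls k = c \<and> \<not> hit (P1 k)")
      case False
      then have "\<forall>k\<in>K. cls k \<in> insert c S \<longrightarrow> hit (P1 k)" using P1(4) by blast
      moreover have "\<forall>k\<in>K. cls k \<notin> insert c S \<longrightarrow> P1 k = P k" using P1(3) by blast
      ultimately show ?thesis using P1(1,2) by blast
    next
      case True
      then obtain k0 where k0: "k0 \<in> K" "cls k0 = c" "\<not> hit (P1 k0)" by blast
      interpret s1: conjugation_state R f F \<epsilon> K h P1 by (rule P1(1))
      define C where "C = {k \<in> K. \<forall>e\<in>E. k e = k0 e}"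
      have C: "k \<in> C \<longleftrightarrow> k \<in> K \<and> cls k = c" for k
        unfolding C_def using cls_eq[of k k0] k0(2) by simp
      have P1C: "P1 k = P k" if "k \<in> C" for k using that C P1(3) insert.hyps by auto
      have k0C: "k0 \<in> C" using k0 C by simp
      have eq: "P k = P k0" if "k \<in> C" for k
        using E0(2)[of k k0] that k0(1) by (auto simp: C_def E_def)
      have "\<exists>P2. conjugation_state R f F \<epsilon> K h P2 \<and> (\<forall>k\<in>K. P1 k \<subseteq> P2 k) \<and>
        (\<forall>k\<in>K. k \<notin> C \<longrightarrow> P2 k = P1 k) \<and> (\<forall>k\<in>C. u \<in> Range (P2 k))"
      proof (rule s1.hit_class[OF k0(1) finE C_def])
        show "P1 k = P1 k0" if "k \<in> C" for k using P1C eq that k0C by metis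
        show "w \<in> E" if "k \<in> C" "k w \<in> Domain (P1 k0)" for k w
        proof -
          have "k w \<in> Domain (P k)" "k \<in> K" using that P1C[OF k0C] eq C by auto
          then show ?thesis unfolding E_def using pull_pointsI by blast
        qed
        show "\<not> same_orbit f e u" if "e \<in> Range (P1 k0)" for e
          using k0(3) that unfolding hit_def by blast
      qed
      then obtain P2 where P2: "conjugation_state R f F \<epsilon> K h P2" "\<forall>k\<in>K. P1 k \<subseteq> P2 k"
        "\<forall>k\<in>K. k \<notin> C \<longrightarrow> P2 k = P1 k" "\<forall>k\<in>C. u \<in> Range (P2 k)"
        by blast
      have "\<forall>k\<in>K. P k \<subseteq> P2 k" using P1(2) P2(2) by blast
      moreover have "\<forall>k\<in>K. cls k \<notin> insert c S \<longrightarrow> P2 k = P k"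
        using P1(3) P2(3) C by simp
      moreover have "hit (P2 k)" if k: "k \<in> K" "cls k \<in> insert c S" for k
      proof (cases "k \<in> C")
        case True
        then show ?thesis using P2(4) same_orbit_refl[of f u] unfolding hit_def by blast
      next
        case False
        then have "hit (P1 k)" using k C P1(4) by blast
        then show ?thesis using hit_mono P2(2) k(1) by blast
      qed
      ultimately show ?thesis using P2(1) by blast
    qed
  qed
  have "cls ` K \<subseteq> Pow (E \<times> push E)" by (auto simp: cls_def push_def)
  moreover have "finite (Pow (E \<times> push E))" using finE by (simp add: finite_push)
  ultimately have "finite (cls ` K)" by (rule finite_subset)
  from step[OF this] obtain P' where P': "conjugation_state R f F \<epsilon> K h P'" "\<forall>k\<in>K. P k \<subseteq> P' k"
    "\<forall>k\<in>K. cls k \<in> cls ` K \<longrightarrow> hit (P' k)"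
    by metis
  then have "\<forall>k\<in>K. hit (P' k)" by blast
  then show ?thesis using P'(1,2) unfolding hit_def by blast
qed

lemma add_points:
  assumes "finite A"
  shows "\<exists>P'. conjugation_state R f F \<epsilon> K h P' \<and> (\<forall>k\<in>K. P k \<subseteq> P' k) \<and> (\<forall>k\<in>K. A \<subseteq> Domain (P' k))"
  using assms
proof (induction A rule: finite_induct)
  case empty
  show ?case using conjugation_state_axioms by blast
next
  case (insert z A)
  then obtain P1 where P1: "conjugation_state R f F \<epsilon> K h P1" "\<forall>k\<in>K. P k \<subseteq> P1 k"
    "\<forall>k\<in>K. A \<subseteq> Domain (P1 k)"
    by blast
  interpret s1: conjugation_state R f F \<epsilon> K h P1 by (rule P1(1))
  obtain P2 where P2: "conjugation_state R f F \<epsilon> K h P2" "\<forall>k\<in>K. P1 k \<subseteq> P2 k" "\<forall>k\<in>K. z \<in> Domain (P2 k)"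
    using s1.add_point[of z] by blast
  have "insert z A \<subseteq> Domain (P2 k)" if k: "k \<in> K" for k
  proof -
    have "Domain (P1 k) \<subseteq> Domain (P2 k)" using P2(2) k by blast
    then show ?thesis using P1(3) P2(3) k by blast
  qed
  moreover have "\<forall>k\<in>K. P k \<subseteq> P2 k" using P1(2) P2(2) by blast
  ultimately show ?case using P2(1) by blast
qed

text \<open>The order matters: \<open>forward\<close> needs \<open>x\<close> in every domain, and
  \<open>backward\<close> needs \<open>k x\<close> in the domain for each \<open>k\<close>, so the
  finite set \<open>push {x}\<close> is added in between.\<close>

lemma advance:
  "\<exists>h' P'. conjugation_state R f F \<epsilon> K h' P' \<and> h \<subseteq> h' \<and> (\<forall>k\<in>K. P k \<subseteq> P' k) \<and>
    x \<in> Domain h' \<and> x \<in> Range h' \<and>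
    (\<forall>k\<in>K. x \<in> Domain (P' k) \<and> (\<exists>e\<in>Range (P' k). same_orbit f e x))"
proof -
  obtain P1 where 1: "conjugation_state R f F \<epsilon> K h P1" "\<forall>k\<in>K. P k \<subseteq> P1 k" "\<forall>k\<in>K. x \<in> Domain (P1 k)"
    using add_point[of x] by blast
  interpret s1: conjugation_state R f F \<epsilon> K h P1 by (rule 1(1))
  obtain h2 P2 where 2: "conjugation_state R f F \<epsilon> K h2 P2" "h \<subseteq> h2" "\<forall>k\<in>K. P1 k \<subseteq> P2 k" "x \<in> Domain h2"
    using s1.forward[of x] 1(3) by metis
  interpret s2: conjugation_state R f F \<epsilon> K h2 P2 by (rule 2(1))
  have fin: "finite (push {x})" by (simp add: finite_push)
  obtain P3 where 3: "conjugation_state R f F \<epsilon> K h2 P3" "\<forall>k\<in>K. P2 k \<subseteq> P3 k"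
    "\<forall>k\<in>K. push {x} \<subseteq> Domain (P3 k)"
    using s2.add_points[OF fin] by blast
  interpret s3: conjugation_state R f F \<epsilon> K h2 P3 by (rule 3(1))
  have "k x \<in> Domain (P3 k)" if "k \<in> K" for k
    using 3(3) that by (auto simp: push_def)
  then obtain h4 P4 where 4: "conjugation_state R f F \<epsilon> K h4 P4" "h2 \<subseteq> h4" "\<forall>k\<in>K. P3 k \<subseteq> P4 k"
    "x \<in> Range h4"
    using s3.backward[of x] by metis
  interpret s4: conjugation_state R f F \<epsilon> K h4 P4 by (rule 4(1))
  obtain P5 where 5: "conjugation_state R f F \<epsilon> K h4 P5" "\<forall>k\<in>K. P4 k \<subseteq> P5 k"
    "\<forall>k\<in>K. \<exists>e\<in>Range (P5 k). same_orbit f e x"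
    using s4.hit_orbit[of x] by blast
  have sub: "P1 k \<subseteq> P5 k" if "k \<in> K" for k
    using 2(3) 3(2) 4(3) 5(2) that by (meson subset_trans)
  have "\<forall>k\<in>K. P k \<subseteq> P5 k \<and> x \<in> Domain (P5 k)"
    using sub 1(2,3) Domain_mono by (metis subsetD subset_trans)
  moreover have "h \<subseteq> h4" "x \<in> Domain h4" using 2(2,4) 4(2) by blast+
  moreover have "\<forall>k\<in>K. P k \<subseteq> P5 k \<and> x \<in> Domain (P5 k) \<and> (\<exists>e\<in>Range (P5 k). same_orbit f e x)"
    using calculation(1) 5(3) by simp
  ultimately show ?thesis using 5(1) 4(4) by metis
qed

end

section \<open>The limit of the stages\<close>

lemma partial_iso_chain:
  fixes r :: "nat \<Rightarrow> ('v \<times> 'v) set"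
  assumes "\<And>n. partial_iso R (r n)" "\<And>m n. m \<le> n \<Longrightarrow> r m \<subseteq> r n"
  shows "partial_iso R (\<Union>n. r n)"
  unfolding partial_iso_def
proof (intro allI impI)
  fix a b a' b' assume "(a, b) \<in> (\<Union>n. r n)" "(a', b') \<in> (\<Union>n. r n)"
  then obtain m n where "(a, b) \<in> r m" "(a', b') \<in> r n" by blast
  then have "(a, b) \<in> r (max m n)" "(a', b') \<in> r (max m n)"
    using assms(2)[OF max.cobounded1, of m n] assms(2)[OF max.cobounded2, of n m] by blast+
  then show "(a = a' \<longleftrightarrow> b = b') \<and> (R a a' \<longleftrightarrow> R b b')"
    using partial_isoD[OF assms(1)] by blast
qed

lemma total_partial_iso:
  assumes r: "partial_iso R r" and "Domain r = UNIV" "Range r = UNIV"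
  obtains g where "g \<in> carrier (graph_aut R)" "\<And>x y. (x, y) \<in> r \<longleftrightarrow> y = g x"
proof -
  define g where "g x = (SOME y. (x, y) \<in> r)" for x
  have g: "(x, g x) \<in> r" for x
  proof -
    have "x \<in> Domain r" using assms(2) by simp
    then show ?thesis unfolding g_def by (auto intro: someI)
  qed
  have iff: "(x, y) \<in> r \<longleftrightarrow> y = g x" for x y
    using partial_isoD(1)[OF r g[of x], of x y] g[of x] by blast
  have inj: "inj g"
    using partial_isoD(1)[OF r g g] by (intro injI) blast
  have "surj g"
    unfolding surj_def
  proof
    fix y
    have "y \<in> Range r" using assms(3) by simp
    then show "\<exists>x. y = g x" using iff by auto
  qed
  with inj have "g \<in> carrier (graph_aut R)"
    using partial_isoD(2)[OF r g g] by (simp add: graph_aut_iff bij_def)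
  then show thesis using iff that by blast
qed

context twisting
begin

text \<open>A point of \<open>F\<close> is reached by \<open>k\<close> only from itself, so both
  sides of \<open>coherent\<close> read \<open>R (f x) w\<close>. Since all domains are equal to
  \<open>F\<close>, \<open>new_type\<close> has no instance.\<close>

lemma initial_state: "conjugation_state R f F \<epsilon> K ((\<lambda>e. (e, f e)) ` F) (\<lambda>_. Id_on F)"
proof unfold_locales
  have fF: "f x \<in> F" if x: "x \<in> F" for x
  proof -
    obtain n where "n > 0" "(f ^^ n) x = x" using F_iff[of x] x by auto
    then have "(f ^^ n) (f x) = f x" by (metis funpow_swap1)
    then show ?thesis using \<open>n > 0\<close> F_iff[of "f x"] by auto
  qed
  have fnF: "(f ^^ n) x \<in> F" if "x \<in> F" for n x
    using that fF by (induction n) auto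
  have kF: "w = k w" if "k \<in> K" "k w \<in> F" for k w
    using K_fix[OF that] K_inj[OF that(1)] by metis
  show "partial_iso R ((\<lambda>e. (e, f e)) ` F)"
    unfolding partial_iso_def using f_inj f_R by auto
  show "(e, f e) \<in> (\<lambda>e. (e, f e)) ` F" if "e \<in> F" for e using that by blast
  show "partial_conjugator R f F ((\<lambda>e. (e, f e)) ` F) k (Id_on F)" if k: "k \<in> K" for k
    unfolding partial_conjugator_def
  proof (intro conjI allI impI ballI)
    show "partial_iso R (Id_on F)" unfolding partial_iso_def by auto
    show "\<exists>v. (a, v) \<in> Id_on F \<and> (k b, f v) \<in> Id_on F" if "(a, b) \<in> (\<lambda>e. (e, f e)) ` F" for a b
      using that fF K_fix[OF k] by (intro exI[of _ a]) auto
    show "(x, w) \<in> (\<lambda>e. (e, f e)) ` F" if "(x, v) \<in> Id_on F" "(k w, f v) \<in> Id_on F" for x v w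
      using that kF[OF k, of w] by auto
    show "(f ^^ m) v \<in> Range (Id_on F)"
      if "v \<in> Range (Id_on F)" "(f ^^ n) v \<in> Range (Id_on F)" "m \<le> n" for v m n
      using that fnF by simp
    show "(e, e) \<in> Id_on F" if "e \<in> F" for e using that by blast
  qed
  show "R (f v) u \<longleftrightarrow> R (f v') u'"
    if "k \<in> K" "k' \<in> K" "(x, v) \<in> Id_on F" "(k w, u) \<in> Id_on F" "(x, v') \<in> Id_on F" "(k' w, u') \<in> Id_on F"
    for k k' x w v u v' u'
  proof -
    have "u = w" "u' = w" using that(4,6) kF[OF that(1), of w] kF[OF that(2), of w] by auto
    then show ?thesis using that(3,5) by auto
  qed
  show "R (f v) u \<longleftrightarrow> \<epsilon> {e \<in> F. R e w}"
    if "k \<in> K" "k' \<in> K" "(k' w, v) \<in> Id_on F" "(k w, u) \<in> Id_on F" "k' w \<notin> Domain (Id_on F)"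
    for k k' w v u
    using that by auto
  have "(\<Union>k\<in>K. Domain (Id_on F)) \<subseteq> F" by auto
  then show "finite (\<Union>k\<in>K. Domain (Id_on F))" using finite_F by (rule finite_subset)
  show "\<exists>E. finite E \<and> (\<forall>k\<in>K. \<forall>k'\<in>K. (\<forall>e\<in>E. k e = k' e) \<longrightarrow> Id_on F = Id_on F)"
    by blast
qed

text \<open>In the union of the stages the range of each lift is closed under \<open>f\<close> by
  the lifting of \<open>h\<close>, and under the inverse of \<open>f\<close> because every point is
  some \<open>k (h a)\<close>. As it meets every orbit, it is everything.\<close>

lemma common_twist:
  assumes enum: "surj (enum :: nat \<Rightarrow> 'v)"
  shows "\<exists>h\<in>carrier (graph_aut R). \<forall>k\<in>K. \<exists>\<phi>\<in>carrier (graph_aut R). \<phi> \<circ> (k \<circ> h) = f \<circ> \<phi>"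
proof -
  define Q where "Q n s s' \<longleftrightarrow> fst s \<subseteq> fst s' \<and> (\<forall>k\<in>K. snd s k \<subseteq> snd s' k) \<and>
    enum n \<in> Domain (fst s') \<and> enum n \<in> Range (fst s') \<and>
    (\<forall>k\<in>K. enum n \<in> Domain (snd s' k) \<and> (\<exists>e\<in>Range (snd s' k). same_orbit f e (enum n)))"
    for n and s s' :: "('v \<times> 'v) set \<times> (('v \<Rightarrow> 'v) \<Rightarrow> ('v \<times> 'v) set)"
  have "\<exists>S. \<forall>n. conjugation_state R f F \<epsilon> K (fst (S n)) (snd (S n)) \<and> Q n (S n) (S (Suc n))"
  proof (rule dependent_nat_choice)
    show "\<exists>s. conjugation_state R f F \<epsilon> K (fst s) (snd s)"
      using initial_state by (metis fst_conv snd_conv)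
    fix s n assume "conjugation_state R f F \<epsilon> K (fst s) (snd s)"
    then obtain h' P' where "conjugation_state R f F \<epsilon> K h' P'" "Q n s (h', P')"
      using conjugation_state.advance[of R f F \<epsilon> K "fst s" "snd s" "enum n"] unfolding Q_def by auto
    then show "\<exists>s'. conjugation_state R f F \<epsilon> K (fst s') (snd s') \<and> Q n s s'"
      by (intro exI[of _ "(h', P')"]) simp
  qed
  then obtain S where S: "\<And>n. conjugation_state R f F \<epsilon> K (fst (S n)) (snd (S n))"
    and QS: "\<And>n. Q n (S n) (S (Suc n))"
    by blast
  define H where "H n = fst (S n)" for n
  define L where "L n = snd (S n)" for n
  have st: "conjugation_state R f F \<epsilon> K (H n) (L n)" for n using S by (simp add: H_def L_def)
  have H_mono: "H m \<subseteq> H n" if "m \<le> n" for m n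
    using lift_Suc_mono_le[of H, OF _ that] QS unfolding Q_def H_def by blast
  have L_mono: "L m k \<subseteq> L n k" if "m \<le> n" "k \<in> K" for m n k
    using lift_Suc_mono_le[of "\<lambda>n. L n k", OF _ that(1)] QS that(2) unfolding Q_def L_def by blast
  define HH where "HH = (\<Union>n. H n)"
  define \<Phi> where "\<Phi> k = (\<Union>n. L n k)" for k
  have "partial_iso R HH"
    unfolding HH_def
    using conjugation_state.h_iso[OF st] H_mono by (rule partial_iso_chain)
  moreover have "x \<in> Domain HH \<and> x \<in> Range HH" for x
  proof -
    obtain n where "x = enum n" using enum by (metis surjD)
    then show ?thesis using QS[of n] unfolding Q_def HH_def H_def by blast
  qed
  ultimately obtain h where h: "h \<in> carrier (graph_aut R)" "\<And>x y. (x, y) \<in> HH \<longleftrightarrow> y = h x"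
    using total_partial_iso[of R HH] by blast
  have "\<exists>\<phi>\<in>carrier (graph_aut R). \<phi> \<circ> (k \<circ> h) = f \<circ> \<phi>" if k: "k \<in> K" for k
  proof -
    have iso: "partial_iso R (\<Phi> k)"
      unfolding \<Phi>_def
      using conjugation_state.P_iso[OF st k] L_mono[OF _ k] by (rule partial_iso_chain)
    have step: "\<exists>v. (x, v) \<in> \<Phi> k \<and> (k (h x), f v) \<in> \<Phi> k" for x
    proof -
      obtain n where "(x, h x) \<in> H n" using h(2)[of x "h x"] by (auto simp: HH_def)
      then obtain v where "(x, v) \<in> L n k" "(k (h x), f v) \<in> L n k"
        using conjugation_state.P_h[OF st k] by metis
      then show ?thesis unfolding \<Phi>_def by blast
    qed
    have dom: "x \<in> Domain (\<Phi> k)" for x using step by blast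
    have up: "f v \<in> Range (\<Phi> k)" if v: "v \<in> Range (\<Phi> k)" for v
    proof -
      obtain x where x: "(x, v) \<in> \<Phi> k" using v by blast
      then show ?thesis using step[of x] partial_isoD(1)[OF iso x] by blast
    qed
    have down: "v \<in> Range (\<Phi> k)" if v: "f v \<in> Range (\<Phi> k)" for v
    proof -
      obtain y where y: "(y, f v) \<in> \<Phi> k" using v by blast
      obtain w where w: "k w = y" using K_surj[OF k] by blast
      obtain a where a: "h a = w" using h(1) by (metis graph_aut_iff bij_is_surj surjD)
      obtain v' where v': "(a, v') \<in> \<Phi> k" "(y, f v') \<in> \<Phi> k" using step[of a] w a by metis
      then have "f v' = f v" using partial_isoD(1)[OF iso y v'(2)] by simp
      then show ?thesis using v'(1) f_inj by auto
    qed
    have up': "(f ^^ n) v \<in> Range (\<Phi> k)" if "v \<in> Range (\<Phi> k)" for n v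
      using that up by (induction n) auto
    have down': "v \<in> Range (\<Phi> k)" if "(f ^^ n) v \<in> Range (\<Phi> k)" for n v
      using that down by (induction n) auto
    have ran: "x \<in> Range (\<Phi> k)" for x
    proof -
      obtain n where "x = enum n" using enum by (metis surjD)
      then obtain e where e: "e \<in> Range (L (Suc n) k)" "same_orbit f e x"
        using QS[of n] k unfolding Q_def L_def by blast
      then have "e \<in> Range (\<Phi> k)" unfolding \<Phi>_def by blast
      then show ?thesis using e(2) up' down' unfolding same_orbit_def by metis
    qed
    obtain \<phi> where \<phi>: "\<phi> \<in> carrier (graph_aut R)" "\<And>x y. (x, y) \<in> \<Phi> k \<longleftrightarrow> y = \<phi> x"
      using total_partial_iso[OF iso] dom ran by blast
    have "\<phi> (k (h x)) = f (\<phi> x)" for x using step[of x] \<phi>(2) by metis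
    then show ?thesis using \<phi>(1) by (intro bexI[of _ \<phi>]) auto
  qed
  then show ?thesis using h(1) by blast
qed

end

section \<open>Conjugacy classes and compact sets of automorphisms\<close>

lemma same_orbit_funpow_iff:
  assumes "inj f"
  shows "same_orbit f ((f ^^ n) v) ((f ^^ n) w) \<longleftrightarrow> same_orbit f v w"
proof -
  have "same_orbit f (f v) (f w) \<longleftrightarrow> same_orbit f v w" for v w
    using same_orbit_apply[OF assms] same_orbit_sym by metis
  then show ?thesis by (induction n) auto
qed

lemma comp_graph_aut:
  assumes "g \<in> carrier (graph_aut R)" "h \<in> carrier (graph_aut R)"
  shows "g \<circ> h \<in> carrier (graph_aut R)"
  using assms by (auto simp: graph_aut_iff intro: bij_comp)

lemma funpow_graph_aut:
  assumes "f \<in> carrier (graph_aut R)"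
  shows "f ^^ n \<in> carrier (graph_aut R)"
proof (induction n)
  case 0
  then show ?case by (simp add: graph_aut_iff bij_id[unfolded id_def])
next
  case (Suc n)
  show ?case unfolding funpow.simps by (rule comp_graph_aut[OF assms Suc])
qed

lemma funpow_multiple_fixed:
  assumes "(f ^^ n) x = x"
  shows "(f ^^ (m * n)) x = x"
  using assms by (induction m) (simp_all add: funpow_add)

lemma common_period:
  assumes "finite F" "\<And>x. x \<in> F \<Longrightarrow> \<exists>n>0. (f ^^ n) x = x"
  shows "\<exists>n>0. \<forall>x\<in>F. (f ^^ n) x = x"
  using assms
proof (induction F rule: finite_induct)
  case (insert x F)
  then obtain m n where mn: "m > 0" "(f ^^ m) x = x" "n > 0" "\<forall>y\<in>F. (f ^^ n) y = y" by blast
  then have "(f ^^ (n * m)) x = x" "\<forall>y\<in>F. (f ^^ (n * m)) y = y"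
    using funpow_multiple_fixed[of m f x n] funpow_multiple_fixed[of n f _ m]
    by (simp_all add: mult.commute)
  then show ?case using mn by (intro exI[of _ "n * m"]) simp
qed auto

text \<open>A type \<open>\<tau>\<^sub>0\<close> that excludes \<open>R (f v) v\<close> can be moved along \<open>f\<close> off any finite set, up
  to the points of \<open>F\<close>, and so combined with any other type that agrees with it on \<open>F\<close>.\<close>

lemma compatible_bit:
  assumes f: "f \<in> carrier (graph_aut R)"
    and F: "finite F" "\<And>x. x \<in> F \<longleftrightarrow> (\<exists>n>0. (f ^^ n) x = x)"
    and ext: "\<And>M \<tau>. finite M \<Longrightarrow> \<exists>v. \<forall>w\<in>M. (R w v \<longleftrightarrow> \<tau> w) \<and> \<not> same_orbit f w v"
  shows "\<exists>\<epsilon>. \<forall>M \<tau>. finite M \<longrightarrow> F \<subseteq> M \<longrightarrow>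
    (\<exists>v. (\<forall>w\<in>M. (R w v \<longleftrightarrow> \<tau> w) \<and> \<not> same_orbit f w v) \<and> (R (f v) v \<longleftrightarrow> \<epsilon> {e \<in> F. \<tau> e}))"
proof -
  have inj: "inj f" and f_R: "R (f x) (f y) \<longleftrightarrow> R x y" for x y
    using f by (auto simp: graph_aut_iff bij_is_inj)
  define good where "good M \<tau> v \<longleftrightarrow> (\<forall>w\<in>M. (R w v \<longleftrightarrow> \<tau> w) \<and> \<not> same_orbit f w v)" for M \<tau> v
  \<comment> \<open>If \<open>\<epsilon> S\<close> fails, some type with trace \<open>S\<close> on
    \<open>F\<close> excludes \<open>R (f v) v\<close>, and it will be glued to any other type with
    this trace.\<close>
  define \<epsilon> where "\<epsilon> S \<longleftrightarrow> (\<forall>M \<tau>. finite M \<longrightarrow> F \<subseteq> M \<longrightarrow> {e \<in> F. \<tau> e} = S \<longrightarrow>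
    (\<exists>v. good M \<tau> v \<and> R (f v) v))" for S
  have "\<exists>v. good M \<tau> v \<and> (R (f v) v \<longleftrightarrow> \<epsilon> {e \<in> F. \<tau> e})" if M: "finite M" "F \<subseteq> M" for M \<tau>
  proof (cases "\<epsilon> {e \<in> F. \<tau> e}")
    case True
    then have "\<exists>v. good M \<tau> v \<and> R (f v) v" using M unfolding \<epsilon>_def by auto
    then show ?thesis using True by auto
  next
    case False
    then obtain M0 \<tau>0 where M0: "finite M0" "F \<subseteq> M0" "{e \<in> F. \<tau>0 e} = {e \<in> F. \<tau> e}"
      and no: "\<And>v. good M0 \<tau>0 v \<Longrightarrow> \<not> R (f v) v"
      unfolding \<epsilon>_def by auto
    \<comment> \<open>Powers of \<open>f ^^ N\<close> fix \<open>F\<close> pointwise, so moving a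
      type along them keeps its trace on \<open>F\<close>.\<close>
    obtain N where N: "N > 0" "\<forall>x\<in>F. (f ^^ N) x = x"
      using common_period[OF F(1)] F(2) by metis
    \<comment> \<open>Outside \<open>F\<close> the iterates of a point are pairwise distinct, so
      only finitely many of them lie in \<open>M\<close>.\<close>
    have "finite {j. (f ^^ (j * N)) a \<in> M}" if a: "a \<notin> F" for a
    proof -
      have "inj (\<lambda>j. (f ^^ (j * N)) a)"
      proof (rule linorder_injI)
        fix i j :: nat assume "i < j"
        have "(f ^^ (j * N)) a = (f ^^ (i * N)) ((f ^^ ((j - i) * N)) a)"
          using \<open>i < j\<close> by (metis add_mult_distrib comp_apply funpow_add le_add_diff_inverse less_imp_le)
        moreover have "(j - i) * N > 0" using \<open>i < j\<close> N(1) by simp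
        then have "(f ^^ ((j - i) * N)) a \<noteq> a" using F(2)[of a] a by blast
        ultimately show "(f ^^ (i * N)) a \<noteq> (f ^^ (j * N)) a"
          using inj_fn[OF inj, of "i * N"] by (metis injD)
      qed
      from finite_vimageI[OF M(1) this] show ?thesis by (simp add: vimage_def)
    qed
    then have "finite (\<Union>a\<in>M0 - F. {j. (f ^^ (j * N)) a \<in> M})" using M0(1) by blast
    then obtain j where j: "j \<notin> (\<Union>a\<in>M0 - F. {j. (f ^^ (j * N)) a \<in> M})"
      using ex_new_if_finite[OF infinite_UNIV_nat] by blast
    define g where "g = f ^^ (j * N)"
    have g_off: "g a \<notin> M" if "a \<in> M0" "a \<notin> F" for a using j that by (auto simp: g_def)
    have g_F: "g a = a" if "a \<in> F" for a
      unfolding g_def using N(2) that by (intro funpow_multiple_fixed) blast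
    have g: "bij g" and g_R: "R (g x) (g y) \<longleftrightarrow> R x y" for x y
      using funpow_graph_aut[OF f, of "j * N"] by (auto simp: graph_aut_iff g_def)
    \<comment> \<open>The glued type: \<open>M\<close> and the image of \<open>M0\<close> under
      \<open>g\<close> meet only in \<open>F\<close>, where \<open>\<tau>\<close> and
      \<open>\<tau>0\<close> have the same trace.\<close>
    define \<tau>' where "\<tau>' w \<longleftrightarrow> (if w \<in> M then \<tau> w else \<tau>0 (inv_map g w))" for w
    have \<tau>': "\<tau>' (g a) \<longleftrightarrow> \<tau>0 a" if "a \<in> M0" for a
    proof (cases "a \<in> F")
      case True
      then have "\<tau>' (g a) \<longleftrightarrow> \<tau> a" using g_F M(2) by (auto simp: \<tau>'_def)
      then show ?thesis using M0(3) True by blast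
    next
      case False
      then show ?thesis using g_off[OF that] g by (simp add: \<tau>'_def bij_is_inj)
    qed
    have "finite (M \<union> g ` M0)" using M(1) M0(1) by simp
    from ext[OF this, of \<tau>'] obtain v where v: "good (M \<union> g ` M0) \<tau>' v"
      unfolding good_def by blast
    obtain v0 where v0: "g v0 = v" using g by (metis bij_is_surj surjD)
    have "good M0 \<tau>0 v0"
      unfolding good_def
    proof
      fix a assume a: "a \<in> M0"
      then have "(R (g a) v \<longleftrightarrow> \<tau>' (g a)) \<and> \<not> same_orbit f (g a) v"
        using v unfolding good_def by blast
      moreover have "same_orbit f (g a) v \<longleftrightarrow> same_orbit f a v0"
        unfolding v0[symmetric] g_def by (rule same_orbit_funpow_iff[OF inj])
      ultimately show "(R a v0 \<longleftrightarrow> \<tau>0 a) \<and> \<not> same_orbit f a v0"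
        using \<tau>'[OF a] g_R[of a v0] v0 by simp
    qed
    then have "\<not> R (f v0) v0" by (rule no)
    \<comment> \<open>As a power of \<open>f\<close>, the map \<open>g\<close> commutes with
      \<open>f\<close>, so the exclusion at \<open>v0\<close> moves to \<open>v\<close>.\<close>
    moreover have "f v = g (f v0)" unfolding v0[symmetric] g_def by (simp add: funpow_swap1)
    ultimately have "\<not> R (f v) v" using g_R[of "f v0" v0] v0 by simp
    moreover have "good M \<tau> v" using v unfolding good_def by (simp add: \<tau>'_def)
    ultimately show ?thesis using False by blast
  qed
  then show ?thesis unfolding good_def by blast
qed

section \<open>From functions to the group and its topology\<close>

lemma graph_aut_mult: "g \<otimes>\<^bsub>graph_aut R\<^esub> h = g \<circ> h"
  by (simp add: graph_aut_def)

lemma graph_aut_inv: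
  assumes "g \<in> carrier (graph_aut R)"
  shows "m_inv (graph_aut R) g = inv_map g"
proof (rule group.inv_equality[OF group_graph_aut])
  have "inj g" using assms by (simp add: graph_aut_iff bij_is_inj)
  then show "inv_map g \<otimes>\<^bsub>graph_aut R\<^esub> g = \<one>\<^bsub>graph_aut R\<^esub>"
    by (simp add: graph_aut_def)
qed (use assms inv_map_graph_aut in auto)

lemma graph_aut_nat_pow: "f [^]\<^bsub>graph_aut R\<^esub> (n :: nat) = f ^^ n"
proof (induction n)
  case 0
  then show ?case by (simp add: nat_pow_def graph_aut_def)
next
  case (Suc n)
  then show ?case by (simp add: nat_pow_def graph_aut_mult funpow_Suc_right del: funpow.simps)
qed

lemma orbit_set_iff:
  assumes "f \<in> carrier (graph_aut R)"
  shows "w \<in> orbit_set R f A \<longleftrightarrow> (\<exists>v\<in>A. same_orbit f v w)"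
proof -
  have bij: "bij f" using assms by (simp add: graph_aut_iff)
  have pos: "f [^]\<^bsub>graph_aut R\<^esub> (int n) = f ^^ n" for n
    by (simp add: int_pow_int graph_aut_nat_pow)
  have neg: "f [^]\<^bsub>graph_aut R\<^esub> (- int n) = inv_map (f ^^ n)" for n
    using group.int_pow_neg_int[OF group_graph_aut assms, of n] graph_aut_inv[OF funpow_graph_aut[OF assms]]
    by (simp add: graph_aut_nat_pow)
  have inv: "inv_map (f ^^ n) v = w \<longleftrightarrow> (f ^^ n) w = v" for n v
    using bij_fn[OF bij, of n] by (metis bij_inv_eq_iff)
  have "(\<exists>k::int. (f [^]\<^bsub>graph_aut R\<^esub> k) v = w) \<longleftrightarrow> same_orbit f v w" for v
  proof
    assume "\<exists>k::int. (f [^]\<^bsub>graph_aut R\<^esub> k) v = w"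
    then obtain k :: int where "(f [^]\<^bsub>graph_aut R\<^esub> k) v = w" by blast
    then show "same_orbit f v w"
      by (cases k rule: int_cases2) (auto simp: pos neg inv same_orbit_def)
  next
    assume "same_orbit f v w"
    then show "\<exists>k::int. (f [^]\<^bsub>graph_aut R\<^esub> k) v = w"
      unfolding same_orbit_def using pos neg inv by metis
  qed
  moreover have "w \<in> orbit_set R f A \<longleftrightarrow> (\<exists>v\<in>A. \<exists>k::int. (f [^]\<^bsub>graph_aut R\<^esub> k) v = w)"
    unfolding orbit_set_def by blast
  ultimately show ?thesis by simp
qed

text \<open>In a finite orbit two iterates coincide, and cancelling gives a period. Conversely the
  first \<open>n\<close> iterates form a finite set mapped injectively into itself, hence onto
  itself, so backward iterates stay in it too.\<close>

lemma finite_orbit_iff: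
  assumes f: "f \<in> carrier (graph_aut R)"
  shows "finite (orbit_set R f {x}) \<longleftrightarrow> (\<exists>n>0. (f ^^ n) x = x)"
proof
  have inj: "inj f" using f by (simp add: graph_aut_iff bij_is_inj)
  {
    assume "finite (orbit_set R f {x})"
    moreover have "range (\<lambda>n. (f ^^ n) x) \<subseteq> orbit_set R f {x}"
      using orbit_set_iff[OF f] same_orbit_funpow(1) by fastforce
    ultimately have "finite (range (\<lambda>n. (f ^^ n) x))" by (rule rev_finite_subset)
    then have "\<not> inj (\<lambda>n. (f ^^ n) x)" using finite_imageD infinite_UNIV_nat by blast
    then obtain i j where ij: "i < j" "(f ^^ i) x = (f ^^ j) x"
      by (meson linorder_injI)
    then have "(f ^^ i) x = (f ^^ i) ((f ^^ (j - i)) x)"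
      by (metis comp_apply funpow_add le_add_diff_inverse less_imp_le)
    then have "(f ^^ (j - i)) x = x" using inj_fn[OF inj] by (metis injD)
    then show "\<exists>n>0. (f ^^ n) x = x" using ij(1) by (intro exI[of _ "j - i"]) simp
  next
    assume "\<exists>n>0. (f ^^ n) x = x"
    then obtain n where n: "n > 0" "(f ^^ n) x = x" by blast
    define A where "A = (\<lambda>i. (f ^^ i) x) ` {..<n}"
    have "finite A" by (simp add: A_def)
    have "f ` A \<subseteq> A"
    proof
      fix y assume "y \<in> f ` A"
      then obtain i where i: "i < n" "y = (f ^^ Suc i) x" by (auto simp: A_def)
      show "y \<in> A"
      proof (cases "Suc i = n")
        case True
        then have "y = (f ^^ 0) x" using i n by simp
        then show ?thesis using n(1) unfolding A_def by blast
      next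
        case False
        then show ?thesis using i unfolding A_def by (intro image_eqI[of _ _ "Suc i"]) auto
      qed
    qed
    then have "f ` A = A"
      using inj \<open>finite A\<close> by (intro endo_inj_surj) (auto intro: inj_on_subset)
    then have fA: "f y \<in> A \<longleftrightarrow> y \<in> A" for y using inj by (metis inj_image_mem_iff)
    have "(f ^^ m) y \<in> A \<longleftrightarrow> y \<in> A" for m y by (induction m) (simp_all add: fA)
    moreover have "x \<in> A" using n(1) unfolding A_def by (intro image_eqI[of _ _ 0]) auto
    ultimately have "w \<in> A" if "same_orbit f x w" for w
      using that unfolding same_orbit_def by metis
    then have "orbit_set R f {x} \<subseteq> A" using orbit_set_iff[OF f] by auto
    then show "finite (orbit_set R f {x})" using \<open>finite A\<close> by (rule finite_subset)
  }
qed

lemma openin_aut_topology_point: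
  "openin (aut_topology R) {k \<in> carrier (graph_aut R). k x = y}"
proof -
  have "continuous_map (aut_topology R) (discrete_topology UNIV) (\<lambda>k. k x)"
    unfolding aut_topology_def
    by (intro continuous_map_from_subtopology continuous_map_product_projection) simp
  then have "openin (aut_topology R) {k \<in> topspace (aut_topology R). k x \<in> {y}}"
    by (rule openin_continuous_map_preimage) simp
  then show ?thesis by (simp add: aut_topology_def)
qed

lemma openin_aut_topology_finite:
  assumes "finite F"
  shows "openin (aut_topology R) {k \<in> carrier (graph_aut R). \<forall>e\<in>F. k e = g e}"
  using assms
proof (induction F rule: finite_induct)
  case empty
  have "topspace (aut_topology R) = carrier (graph_aut R)" by (simp add: aut_topology_def)
  then show ?case using openin_topspace[of "aut_topology R"] by simp
next
  case (insert x F)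
  have "{k \<in> carrier (graph_aut R). \<forall>e\<in>insert x F. k e = g e} =
    {k \<in> carrier (graph_aut R). k x = g x} \<inter> {k \<in> carrier (graph_aut R). \<forall>e\<in>F. k e = g e}"
    by blast
  then show ?case using openin_Int[OF openin_aut_topology_point insert.IH] by simp
qed

lemma compactin_aut_topology_subset:
  "compactin (aut_topology R) K \<Longrightarrow> K \<subseteq> carrier (graph_aut R)"
  using compactin_subset_topspace by (fastforce simp: aut_topology_def)

lemma compactin_aut_topology_finite_image:
  assumes "compactin (aut_topology R) K"
  shows "finite {k x | k. k \<in> K}"
proof -
  define U where "U y = {k \<in> carrier (graph_aut R). k x = y}" for y
  have "\<And>V. V \<in> range U \<Longrightarrow> openin (aut_topology R) V"
    using openin_aut_topology_point by (auto simp: U_def)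
  moreover have "K \<subseteq> \<Union> (range U)"
    using compactin_aut_topology_subset[OF assms] by (auto simp: U_def)
  ultimately obtain \<F> where "finite \<F>" "\<F> \<subseteq> range U" "K \<subseteq> \<Union> \<F>"
    using compactinD[OF assms, of "range U"] by blast
  then obtain Y where "finite Y" "K \<subseteq> \<Union> (U ` Y)"
    using finite_subset_image[of \<F> U UNIV] by blast
  then have "{k x | k. k \<in> K} \<subseteq> Y" by (auto simp: U_def)
  then show ?thesis using \<open>finite Y\<close> by (rule finite_subset)
qed

text \<open>The open sets of automorphisms sending \<open>w\<close> to \<open>x\<close> cover
  \<open>K\<close> as \<open>w\<close> varies; by injectivity they are disjoint, so a finite
  subcover lists all preimages.\<close>

lemma compactin_aut_topology_finite_preimage:
  assumes "compactin (aut_topology R) K"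
  shows "finite {w. \<exists>k\<in>K. k w = x}"
proof -
  define U where "U w = {k \<in> carrier (graph_aut R). k w = x}" for w
  have K: "K \<subseteq> carrier (graph_aut R)" using compactin_aut_topology_subset[OF assms] .
  have "\<And>V. V \<in> range U \<Longrightarrow> openin (aut_topology R) V"
    using openin_aut_topology_point by (auto simp: U_def)
  moreover have "K \<subseteq> \<Union> (range U)"
  proof
    fix k assume "k \<in> K"
    then have k: "k \<in> carrier (graph_aut R)" using K by blast
    then obtain w where "k w = x" by (metis graph_aut_iff bij_is_surj surjD)
    then show "k \<in> \<Union> (range U)" using k by (auto simp: U_def)
  qed
  ultimately obtain \<F> where "finite \<F>" "\<F> \<subseteq> range U" "K \<subseteq> \<Union> \<F>"
    using compactinD[OF assms, of "range U"] by blast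
  then obtain Y where Y: "finite Y" "K \<subseteq> \<Union> (U ` Y)"
    using finite_subset_image[of \<F> U UNIV] by blast
  have "{w. \<exists>k\<in>K. k w = x} \<subseteq> Y"
  proof
    fix w assume "w \<in> {w. \<exists>k\<in>K. k w = x}"
    then obtain k where k: "k \<in> K" "k w = x" by blast
    then obtain w' where w': "w' \<in> Y" "k w' = x" using Y(2) by (auto simp: U_def)
    have "inj k" using K k(1) by (auto simp: graph_aut_iff bij_is_inj)
    then have "w = w'" using k(2) w'(2) by (metis injD)
    then show "w \<in> Y" using w'(1) by simp
  qed
  then show ?thesis using Y(1) by (rule finite_subset)
qed

text \<open>An arbitrary subset \<open>L\<close> of the compact \<open>K\<close> covers both uses,
  all of \<open>K\<close> and a part \<open>U \<inter> K\<close>; finiteness of evaluations passes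
  to subsets.\<close>

lemma translate_into_conjugacy_class:
  fixes R :: "'v::countable \<Rightarrow> 'v \<Rightarrow> bool"
  assumes R: "random_graph R" and f: "f \<in> carrier (graph_aut R)" and star: "property_star R f"
    and F_def: "F = {x. \<exists>n>0. (f ^^ n) x = x}"
    and K: "compactin (aut_topology R) K" and L: "L \<subseteq> K"
    and agree: "\<And>k k' e. k \<in> L \<Longrightarrow> k' \<in> L \<Longrightarrow> e \<in> F \<Longrightarrow> k e = k' e"
    and F: "finite F"
  shows "\<exists>g\<in>carrier (graph_aut R). \<exists>h\<in>carrier (graph_aut R).
    g <#\<^bsub>graph_aut R\<^esub> L #>\<^bsub>graph_aut R\<^esub> h \<subseteq> conjugacy_class (graph_aut R) f"
proof (cases "L = {}")
  case True
  \<comment> \<open>A catcher must also treat the empty compact set, to which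
    \<open>twisting\<close> does not apply.\<close>
  have "id \<in> carrier (graph_aut R)" by (simp add: graph_aut_iff)
  then show ?thesis using True by (auto simp: l_coset_def r_coset_def)
next
  case False
  then obtain k0 where k0: "k0 \<in> L" by blast
  have LA: "L \<subseteq> carrier (graph_aut R)" using L compactin_aut_topology_subset[OF K] by blast
  define g where "g = inv_map k0"
  have g: "g \<in> carrier (graph_aut R)" unfolding g_def using LA k0 inv_map_graph_aut by blast
  then have bij_g: "bij g" by (simp add: graph_aut_iff)
  have g_eq: "g x = y \<longleftrightarrow> k0 y = x" for x y
    using LA k0 unfolding g_def by (metis bij_inv_eq_iff graph_aut_iff subsetD)
  have star_ext: "\<exists>v. \<forall>w\<in>M. (R w v \<longleftrightarrow> \<tau> w) \<and> \<not> same_orbit f w v" if "finite M" for M \<tau>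
  proof -
    obtain v where "realizes R M \<tau> v" "v \<notin> orbit_set R f M"
      using star \<open>finite M\<close> unfolding property_star_def by metis
    then show ?thesis unfolding realizes_def using orbit_set_iff[OF f] by auto
  qed
  have F_iff: "x \<in> F \<longleftrightarrow> (\<exists>n>0. (f ^^ n) x = x)" for x by (simp add: F_def)
  obtain \<epsilon> where \<epsilon>: "\<forall>M \<tau>. finite M \<longrightarrow> F \<subseteq> M \<longrightarrow>
    (\<exists>v. (\<forall>w\<in>M. (R w v \<longleftrightarrow> \<tau> w) \<and> \<not> same_orbit f w v) \<and> (R (f v) v \<longleftrightarrow> \<epsilon> {e \<in> F. \<tau> e}))"
    using compatible_bit[OF f F F_iff star_ext] by blast
  have "twisting R f F \<epsilon> ((\<lambda>k. g \<circ> k) ` L)"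
  proof unfold_locales
    show "symp R" "irreflp R" using R by (auto simp: random_graph_def)
    show "f \<in> carrier (graph_aut R)" "finite F" by (rule f, rule F)
    show "x \<in> F \<longleftrightarrow> (\<exists>n>0. (f ^^ n) x = x)" for x by (rule F_iff)
    show "\<exists>v. (\<forall>w\<in>M. (R w v \<longleftrightarrow> \<tau> w) \<and> \<not> same_orbit f w v) \<and> (R (f v) v \<longleftrightarrow> \<epsilon> {e \<in> F. \<tau> e})"
      if "finite M" "F \<subseteq> M" for M \<tau>
      using \<epsilon> that by blast
    show "(\<lambda>k. g \<circ> k) ` L \<noteq> {}" using False by simp
    show "(\<lambda>k. g \<circ> k) ` L \<subseteq> carrier (graph_aut R)"
      using LA g comp_graph_aut by blast
    show "k e = e" if "k \<in> (\<lambda>k. g \<circ> k) ` L" "e \<in> F" for k e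
      using that agree[OF _ k0] g_eq by auto
    show "finite {k x |k. k \<in> (\<lambda>k. g \<circ> k) ` L}" for x
    proof -
      have "{k x |k. k \<in> L} \<subseteq> {k x |k. k \<in> K}" using L by blast
      then have "finite (g ` {k x |k. k \<in> L})"
        using compactin_aut_topology_finite_image[OF K, of x] finite_subset by blast
      moreover have "{k x |k. k \<in> (\<lambda>k. g \<circ> k) ` L} = g ` {k x |k. k \<in> L}" by force
      ultimately show ?thesis by simp
    qed
    show "finite {w. \<exists>k\<in>(\<lambda>k. g \<circ> k) ` L. k w = x}" for x
    proof (rule finite_subset)
      show "{w. \<exists>k\<in>(\<lambda>k. g \<circ> k) ` L. k w = x} \<subseteq> {w. \<exists>k\<in>K. k w = k0 x}"
        using L by (auto simp: g_eq)
      show "finite {w. \<exists>k\<in>K. k w = k0 x}"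
        by (rule compactin_aut_topology_finite_preimage[OF K])
    qed
  qed
  then obtain h where h: "h \<in> carrier (graph_aut R)"
    and conj: "\<And>k. k \<in> L \<Longrightarrow> \<exists>\<phi>\<in>carrier (graph_aut R). \<phi> \<circ> ((g \<circ> k) \<circ> h) = f \<circ> \<phi>"
    using twisting.common_twist[OF _ surj_from_nat] by fastforce
  have "g \<circ> k \<circ> h \<in> conjugacy_class (graph_aut R) f" if k: "k \<in> L" for k
  proof -
    obtain \<phi> where \<phi>: "\<phi> \<in> carrier (graph_aut R)" "\<phi> \<circ> ((g \<circ> k) \<circ> h) = f \<circ> \<phi>"
      using conj[OF k] by blast
    have bij: "bij \<phi>" using \<phi>(1) by (simp add: graph_aut_iff)
    have \<psi>: "inv_map \<phi> \<in> carrier (graph_aut R)" using inv_map_graph_aut[OF \<phi>(1)] .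
    have "inv_map \<phi> \<circ> (\<phi> \<circ> (g \<circ> k \<circ> h)) = g \<circ> k \<circ> h"
      using bij by (simp add: o_assoc bij_is_inj)
    then have "g \<circ> k \<circ> h = inv_map \<phi> \<circ> f \<circ> \<phi>"
      unfolding \<phi>(2) by (simp add: o_assoc)
    also have "\<dots> = inv_map \<phi> \<otimes>\<^bsub>graph_aut R\<^esub> f \<otimes>\<^bsub>graph_aut R\<^esub> m_inv (graph_aut R) (inv_map \<phi>)"
      using graph_aut_inv[OF \<psi>] bij by (simp add: graph_aut_mult inv_inv_eq)
    finally show ?thesis using \<psi> unfolding conjugacy_class_def by blast
  qed
  then have "g <#\<^bsub>graph_aut R\<^esub> L #>\<^bsub>graph_aut R\<^esub> h \<subseteq> conjugacy_class (graph_aut R) f"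
    by (auto simp: l_coset_def r_coset_def graph_aut_mult)
  then show ?thesis using g h by blast
qed

theorem theorem2p22:
  fixes R :: "'v::countable \<Rightarrow> 'v \<Rightarrow> bool" and f :: "'v \<Rightarrow> 'v"
  assumes "random_graph R"
    and "f \<in> carrier (graph_aut R)"
    and "property_star R f"
  shows "compact_biter (graph_aut R) (aut_topology R) (conjugacy_class (graph_aut R) f) \<and>
    ((\<forall>X\<in>orbits R f. infinite X) \<longrightarrow>
       compact_catcher (graph_aut R) (aut_topology R) (conjugacy_class (graph_aut R) f))"
proof -
  define F where "F = {x. \<exists>n>0. (f ^^ n) x = x}"
  have F_orbit: "x \<in> orbit_set R f {x} \<and> orbit_set R f {x} \<in> {X \<in> orbits R f. finite X}" if "x \<in> F" for x
    using that finite_orbit_iff[OF assms(2)] orbit_set_iff[OF assms(2)] same_orbit_refl[of f x]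
    unfolding F_def orbits_def by auto
  have "finite (\<Union> {X \<in> orbits R f. finite X})"
    using assms(3) unfolding property_star_def by auto
  moreover have "F \<subseteq> \<Union> {X \<in> orbits R f. finite X}" using F_orbit by blast
  ultimately have F: "finite F" by (rule rev_finite_subset)
  note translate = translate_into_conjugacy_class[OF assms F_def _ _ _ F]
  have "compact_biter (graph_aut R) (aut_topology R) (conjugacy_class (graph_aut R) f)"
    unfolding compact_biter_def
  proof (intro allI impI)
    fix K assume K: "compactin (aut_topology R) K \<and> K \<noteq> {}"
    then obtain k0 where k0: "k0 \<in> K" by blast
    define U where "U = {k \<in> carrier (graph_aut R). \<forall>e\<in>F. k e = k0 e}"
    have "openin (aut_topology R) U"
      unfolding U_def using F by (rule openin_aut_topology_finite)
    moreover have "U \<inter> K \<noteq> {}"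
      using k0 K compactin_aut_topology_subset[of R K] by (auto simp: U_def)
    moreover have "\<exists>g\<in>carrier (graph_aut R). \<exists>h\<in>carrier (graph_aut R).
        g <#\<^bsub>graph_aut R\<^esub> (U \<inter> K) #>\<^bsub>graph_aut R\<^esub> h \<subseteq> conjugacy_class (graph_aut R) f"
      using K by (intro translate[of K]) (auto simp: U_def)
    ultimately show "\<exists>U. openin (aut_topology R) U \<and> U \<inter> K \<noteq> {} \<and>
        (\<exists>g\<in>carrier (graph_aut R). \<exists>h\<in>carrier (graph_aut R).
          g <#\<^bsub>graph_aut R\<^esub> (U \<inter> K) #>\<^bsub>graph_aut R\<^esub> h \<subseteq> conjugacy_class (graph_aut R) f)"
      by blast
  qed
  moreover have "compact_catcher (graph_aut R) (aut_topology R) (conjugacy_class (graph_aut R) f)"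
    if "\<forall>X\<in>orbits R f. infinite X"
  proof -
    have "F = {}" using F_orbit that by blast
    then show ?thesis
      unfolding compact_catcher_def by (intro allI impI translate) auto
  qed
  ultimately show ?thesis by blast
qed

end
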